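(* Let $\mathcal{M}$ be a countable structure in a countable relational language and $\alpha\ge1$ a countable ordinal. Let $(\Gamma_i)_{i \in \omega}$ be a list of $\Pi_{\alpha}$-types none of which is $\Sigma_{\alpha}$-supported in $\mathcal{M}$, and let $\varphi$ be a $\Pi_{\alpha+1}$ sentence true in $\mathcal{M}$. Then there is a structure $\mathcal{N}$ with $\mathcal{N} \leq_\alpha \mathcal{M}$ such that $\mathcal{N} \models \varphi$ and $\mathcal{N}$ omits every $\Gamma_i$.
   Context: Formulas are in $\mathcal{L}_{\omega_1\omega}$. $\Sigma_0=\Pi_0$ are the finitary quantifier-free formulas; a $\Sigma_\alpha$ formula is $\bigvee_i \exists \bar{y}_i \psi_i$ and a $\Pi_\alpha$ formula is $\bigwedge_i \forall \bar{y}_i \psi_i$ (countable index sets), with each $\psi_i$ in $\Pi_\beta$ for some $\beta<\alpha$. A $\Pi_\alpha$-type $\Gamma(\bar x)$ is a set of $\Pi_\alpha$ formulas in the free variables $\bar x$; it is $\Sigma_\alpha$-supported in $\mathcal{M}$ if there is a $\Sigma_\alpha$ formula $\theta(\bar x)$ satisfied by some tuple of $\mathcal{M}$ such that every tuple of $\mathcal{M}$ satisfying $\theta$ satisfies every formula of $\Gamma$. A structure omits $\Gamma$ if no tuple of it satisfies all formulas of $\Gamma$. Fix an enumeration of the atomic formulas. $(\mathcal{M},\bar{a}) \leq_0 (\mathcal{N},\bar{b})$ if $\bar a,\bar b$ satisfy the same formulas among the first $|\bar a|$ atomic formulas; for $\alpha>0$, $(\mathcal{M},\bar{a}) \leq_\alpha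 (\mathcal{N},\bar{b})$ if for every $\beta<\alpha$ and every tuple $\bar d\in\mathcal{N}$ there is $\bar c\in\mathcal{M}$ with $(\mathcal{N},\bar b\bar d)\leq_\beta(\mathcal{M},\bar a\bar c)$; $\mathcal{N}\le_\alpha\mathcal{M}$ is this with empty tuples. *)

theory Defs
  imports "HOL-Library.Countable_Set_Type"
begin

section \<open>Countable ordinals\<close>

text \<open>The elements of \<open>\<omega>\<^sub>1\<close>, the cardinal successor of \<open>\<omega>\<close>, are the countable ordinals.\<close>

typedef countable_ordinal = "Field (cardSuc natLeq)"
  using Field_cardSuc_not_empty[OF natLeq_Card_order] by blast

lemma Well_order_cardSuc_natLeq: "Well_order (cardSuc natLeq)"
  using cardSuc_Card_order[OF natLeq_Card_order] by (simp add: card_order_on_def)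

instantiation countable_ordinal :: wellorder
begin

definition less_eq_countable_ordinal :: "countable_ordinal \<Rightarrow> countable_ordinal \<Rightarrow> bool" where
  "\<alpha> \<le> \<beta> \<longleftrightarrow> (Rep_countable_ordinal \<alpha>, Rep_countable_ordinal \<beta>) \<in> cardSuc natLeq"

definition less_countable_ordinal :: "countable_ordinal \<Rightarrow> countable_ordinal \<Rightarrow> bool" where
  "\<alpha> < \<beta> \<longleftrightarrow> \<alpha> \<le> \<beta> \<and> \<not> \<beta> \<le> (\<alpha> :: countable_ordinal)"

instance
proof
  note W = Well_order_cardSuc_natLeq
  have R: "Refl (cardSuc natLeq)" and T: "trans (cardSuc natLeq)"
    and A: "antisym (cardSuc natLeq)" and Tot: "Total (cardSuc natLeq)"
    and wf: "wf (cardSuc natLeq - Id)"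
    using W by (auto simp: well_order_on_def linear_order_on_def partial_order_on_def preorder_on_def)
  fix x y z :: countable_ordinal
  show "x < y \<longleftrightarrow> x \<le> y \<and> \<not> y \<le> x" by (rule less_countable_ordinal_def)
  show refl: "x \<le> x"
    using R Rep_countable_ordinal[of x] by (auto simp: less_eq_countable_ordinal_def refl_on_def)
  show "x \<le> y \<Longrightarrow> y \<le> z \<Longrightarrow> x \<le> z"
    using T by (auto simp: less_eq_countable_ordinal_def elim: transE)
  show "x \<le> y \<Longrightarrow> y \<le> x \<Longrightarrow> x = y"
    using A by (auto simp: less_eq_countable_ordinal_def Rep_countable_ordinal_inject dest: antisymD)
  show "x \<le> y \<or> y \<le> x"
    using Tot Rep_countable_ordinal[of x] Rep_countable_ordinal[of y] refl
    by (cases "x = y")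
      (auto simp: less_eq_countable_ordinal_def total_on_def Rep_countable_ordinal_inject)
  fix P :: "countable_ordinal \<Rightarrow> bool" and a
  assume step: "\<And>x. (\<And>y. y < x \<Longrightarrow> P y) \<Longrightarrow> P x"
  have "wf (inv_image (cardSuc natLeq - Id) Rep_countable_ordinal)"
    using wf by (rule wf_inv_image)
  then show "P a"
  proof (induction a rule: wf_induct_rule)
    case (less x)
    show ?case
      by (rule step, rule less)
        (use A in \<open>auto simp: less_countable_ordinal_def less_eq_countable_ordinal_def
          Rep_countable_ordinal_inject\<close>)
  qed
qed

end

lemma countable_lessThan_countable_ordinal:
  includes cardinal_syntax
  shows "countable {..<\<alpha> :: countable_ordinal}"
proof -
  let ?f = Rep_countable_ordinal
  have inj: "inj_on ?f {..<\<alpha>}"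
    by (auto simp: inj_on_def Rep_countable_ordinal_inject)
  have "?f ` {..<\<alpha>} \<subseteq> underS (cardSuc natLeq) (?f \<alpha>)"
    by (auto simp: underS_def less_countable_ordinal_def less_eq_countable_ordinal_def
        Rep_countable_ordinal_inject)
  moreover have "|underS (cardSuc natLeq) (?f \<alpha>)| <o cardSuc natLeq"
    using card_of_underS[OF cardSuc_Card_order[OF natLeq_Card_order] Rep_countable_ordinal] .
  then have "countable (underS (cardSuc natLeq) (?f \<alpha>))"
    by (simp add: countable_card_le_natLeq
        cardSuc_ordLeq_ordLess[OF natLeq_Card_order card_of_Card_order])
  ultimately have "countable (?f ` {..<\<alpha>})" by (rule countable_subset)
  then show ?thesis using inj by (simp add: countable_image_inj_eq)
qed

lemma uncountable_UNIV_countable_ordinal: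
  includes cardinal_syntax
  shows "uncountable (UNIV :: countable_ordinal set)"
proof
  assume "countable (UNIV :: countable_ordinal set)"
  then have "countable (range Rep_countable_ordinal)" by (rule countable_image)
  then have "countable (Field (cardSuc natLeq))"
    by (simp add: type_definition.Rep_range[OF type_definition_countable_ordinal])
  then have "|Field (cardSuc natLeq)| \<le>o natLeq" by (simp add: countable_card_le_natLeq)
  then have "cardSuc natLeq \<le>o natLeq"
    using card_of_Field_ordIso[OF cardSuc_Card_order[OF natLeq_Card_order]]
      ordIso_ordLeq_trans ordIso_symmetric by blast
  then show False
    using cardSuc_greater[OF natLeq_Card_order] not_ordLess_ordLeq by blast
qed

lemma countable_ordinal_gt_ex: "\<exists>\<beta> :: countable_ordinal. \<alpha> < \<beta>"
proof (rule ccontr)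
  assume "\<not> ?thesis"
  then have "UNIV = insert \<alpha> {..<\<alpha>}" by (auto simp: not_less order.order_iff_strict)
  then show False
    using uncountable_UNIV_countable_ordinal countable_lessThan_countable_ordinal
    by (metis countable_insert)
qed

definition osucc :: "countable_ordinal \<Rightarrow> countable_ordinal" where
  "osucc \<alpha> = (LEAST \<beta>. \<alpha> < \<beta>)"

lemma less_osucc_iff: "\<beta> < osucc \<alpha> \<longleftrightarrow> \<beta> \<le> \<alpha>"
  unfolding osucc_def using countable_ordinal_gt_ex[of \<alpha>]
  by (metis LeastI_ex leD leI le_less_trans not_less_Least)

instantiation countable_ordinal :: "{zero, one}"
begin

definition zero_countable_ordinal :: countable_ordinal where
  "0 = (LEAST \<alpha> :: countable_ordinal. True)"
definition one_countable_ordinal :: countable_ordinal where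
  "1 = osucc 0"

instance ..

end

lemma zero_le_countable_ordinal: "0 \<le> (\<alpha> :: countable_ordinal)"
  unfolding zero_countable_ordinal_def by (rule Least_le) simp

lemma one_le_countable_ordinal_iff: "1 \<le> \<alpha> \<longleftrightarrow> 0 < (\<alpha> :: countable_ordinal)"
  unfolding one_countable_ordinal_def using less_osucc_iff[of \<alpha> 0]
  by (metis leD leI)


section \<open>Relational languages, structures, and infinitary formulas\<close>

text \<open>A relational language is a partial map \<open>L\<close>: its symbols are the elements of \<open>dom L\<close>, and
  \<open>L R = Some k\<close> says that \<open>R\<close> has arity \<open>k\<close>. Only the values of \<open>interp M R\<close> for symbols \<open>R\<close> of
  the language, at tuples of the right length from \<open>universe M\<close>, are ever relevant.\<close>

type_synonym 'r language = "'r \<rightharpoonup> nat"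

record ('r, 'a) relstruct =
  universe :: "'a set"
  interp :: "'r \<Rightarrow> 'a list \<Rightarrow> bool"

definition tuples :: "('r, 'a) relstruct \<Rightarrow> nat \<Rightarrow> 'a list set" where
  "tuples M n = {a. length a = n \<and> set a \<subseteq> universe M}"

datatype 'r atom = Eq nat nat | Rel 'r "nat list"

fun atom_vars :: "'r atom \<Rightarrow> nat set" where
  "atom_vars (Eq x y) = {x, y}"
| "atom_vars (Rel R xs) = set xs"

fun atom_sat :: "('r, 'a) relstruct \<Rightarrow> (nat \<Rightarrow> 'a) \<Rightarrow> 'r atom \<Rightarrow> bool" where
  "atom_sat M v (Eq x y) \<longleftrightarrow> v x = v y"
| "atom_sat M v (Rel R xs) \<longleftrightarrow> interp M R (map v xs)"

definition atoms :: "'r language \<Rightarrow> 'r atom set" where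
  "atoms L = {Eq x y | x y. True} \<union> {Rel R xs | R xs. L R = Some (length xs)}"

text \<open>In \<open>Disj I f\<close> and \<open>Conj I f\<close> the index set is \<open>I\<close>; the values of \<open>f\<close> outside \<open>I\<close> play no role.\<close>

datatype 'r fm =
    Atom "'r atom"
  | Neg "'r fm"
  | Disj "nat set" "nat \<Rightarrow> 'r fm"
  | Conj "nat set" "nat \<Rightarrow> 'r fm"
  | Exists nat "'r fm"
  | Forall nat "'r fm"

primrec fv :: "'r fm \<Rightarrow> nat set" where
  "fv (Atom A) = atom_vars A"
| "fv (Neg \<phi>) = fv \<phi>"
| "fv (Disj I f) = (\<Union>i\<in>I. fv (f i))"
| "fv (Conj I f) = (\<Union>i\<in>I. fv (f i))"
| "fv (Exists x \<phi>) = fv \<phi> - {x}"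
| "fv (Forall x \<phi>) = fv \<phi> - {x}"

primrec sat :: "('r, 'a) relstruct \<Rightarrow> 'r fm \<Rightarrow> (nat \<Rightarrow> 'a) \<Rightarrow> bool" where
  "sat M (Atom A) v \<longleftrightarrow> atom_sat M v A"
| "sat M (Neg \<phi>) v \<longleftrightarrow> \<not> sat M \<phi> v"
| "sat M (Disj I f) v \<longleftrightarrow> (\<exists>i\<in>I. sat M (f i) v)"
| "sat M (Conj I f) v \<longleftrightarrow> (\<forall>i\<in>I. sat M (f i) v)"
| "sat M (Exists x \<phi>) v \<longleftrightarrow> (\<exists>d\<in>universe M. sat M \<phi> (v(x := d)))"
| "sat M (Forall x \<phi>) v \<longleftrightarrow> (\<forall>d\<in>universe M. sat M \<phi> (v(x := d)))"

text \<open>Satisfaction by a tuple, for formulas with free variables among the first \<open>length a\<close>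
  variables; the values of \<open>(!) a\<close> beyond the length of the tuple are then irrelevant.\<close>

definition tuple_sat :: "('r, 'a) relstruct \<Rightarrow> 'a list \<Rightarrow> 'r fm \<Rightarrow> bool" where
  "tuple_sat M a \<phi> \<longleftrightarrow> sat M \<phi> ((!) a)"

definition sentence :: "'r fm \<Rightarrow> bool" where
  "sentence \<phi> \<longleftrightarrow> fv \<phi> = {}"

definition models :: "('r, 'a) relstruct \<Rightarrow> 'r fm \<Rightarrow> bool" where
  "models M \<phi> \<longleftrightarrow> tuple_sat M [] \<phi>"

inductive finitary_qf :: "'r language \<Rightarrow> 'r fm \<Rightarrow> bool" for L where
  "A \<in> atoms L \<Longrightarrow> finitary_qf L (Atom A)"
| "finitary_qf L \<phi> \<Longrightarrow> finitary_qf L (Neg \<phi>)"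
| "finite I \<Longrightarrow> (\<And>i. i \<in> I \<Longrightarrow> finitary_qf L (f i)) \<Longrightarrow> finitary_qf L (Disj I f)"
| "finite I \<Longrightarrow> (\<And>i. i \<in> I \<Longrightarrow> finitary_qf L (f i)) \<Longrightarrow> finitary_qf L (Conj I f)"

inductive is_Sigma :: "'r language \<Rightarrow> countable_ordinal \<Rightarrow> 'r fm \<Rightarrow> bool"
  and is_Pi :: "'r language \<Rightarrow> countable_ordinal \<Rightarrow> 'r fm \<Rightarrow> bool"
  for L where
  Sigma_0: "finitary_qf L \<phi> \<Longrightarrow> is_Sigma L 0 \<phi>"
| Pi_0: "finitary_qf L \<phi> \<Longrightarrow> is_Pi L 0 \<phi>"
| Sigma: "0 < \<alpha> \<Longrightarrow>
    (\<And>i. i \<in> I \<Longrightarrow> f i = foldr Exists (ys i) (\<psi> i) \<and> \<beta> i < \<alpha> \<and> is_Pi L (\<beta> i) (\<psi> i)) \<Longrightarrow>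
    is_Sigma L \<alpha> (Disj I f)"
| Pi: "0 < \<alpha> \<Longrightarrow>
    (\<And>i. i \<in> I \<Longrightarrow> f i = foldr Forall (ys i) (\<psi> i) \<and> \<beta> i < \<alpha> \<and> is_Sigma L (\<beta> i) (\<psi> i)) \<Longrightarrow>
    is_Pi L \<alpha> (Conj I f)"


section \<open>Types\<close>

text \<open>A type \<open>\<Gamma>(x\<^sub>0, \<dots>, x\<^sub>n\<^sub>-\<^sub>1)\<close> is given by \<open>n\<close> together with its set of formulas.\<close>

definition Pi_type :: "'r language \<Rightarrow> countable_ordinal \<Rightarrow> nat \<Rightarrow> 'r fm set \<Rightarrow> bool" where
  "Pi_type L \<alpha> n \<Gamma> \<longleftrightarrow> (\<forall>\<gamma>\<in>\<Gamma>. is_Pi L \<alpha> \<gamma> \<and> fv \<gamma> \<subseteq> {..<n})"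

definition Sigma_supported ::
  "'r language \<Rightarrow> countable_ordinal \<Rightarrow> ('r, 'a) relstruct \<Rightarrow> nat \<Rightarrow> 'r fm set \<Rightarrow> bool" where
  "Sigma_supported L \<alpha> M n \<Gamma> \<longleftrightarrow>
    (\<exists>\<theta>. is_Sigma L \<alpha> \<theta> \<and> fv \<theta> \<subseteq> {..<n} \<and>
      (\<exists>a\<in>tuples M n. tuple_sat M a \<theta>) \<and>
      (\<forall>a\<in>tuples M n. tuple_sat M a \<theta> \<longrightarrow> (\<forall>\<gamma>\<in>\<Gamma>. tuple_sat M a \<gamma>)))"

definition omits :: "('r, 'a) relstruct \<Rightarrow> nat \<Rightarrow> 'r fm set \<Rightarrow> bool" where
  "omits M n \<Gamma> \<longleftrightarrow> \<not> (\<exists>a\<in>tuples M n. \<forall>\<gamma>\<in>\<Gamma>. tuple_sat M a \<gamma>)"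


section \<open>Back-and-forth relations\<close>

text \<open>Here \<open>e\<close> is the enumeration of the atomic formulas. Among the first \<open>length a\<close> of them, those
  mentioning a variable beyond the tuple have no truth value at the tuple and are skipped.\<close>

definition bf_0 ::
  "(nat \<Rightarrow> 'r atom) \<Rightarrow> ('r, 'a) relstruct \<Rightarrow> ('r, 'b) relstruct \<Rightarrow> 'a list \<Rightarrow> 'b list \<Rightarrow> bool" where
  "bf_0 e M N a b \<longleftrightarrow> length a = length b \<and>
    (\<forall>i<length a. atom_vars (e i) \<subseteq> {..<length a} \<longrightarrow>
      (atom_sat M ((!) a) (e i) \<longleftrightarrow> atom_sat N ((!) b) (e i)))"

text \<open>\<open>bf_le e M N \<alpha> a b\<close> is \<open>(M, a) \<le>\<^sub>\<alpha> (N, b)\<close>. The recursion interchanges the two structures, whose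
  universes may have different types, so the reverse relation is defined simultaneously:
  \<open>bf_ge e M N \<alpha> a b\<close> is \<open>(N, b) \<le>\<^sub>\<alpha> (M, a)\<close>. By well-foundedness the recursive equations have a
  unique solution, so the inductive definition is the recursive one.\<close>

inductive bf_le ::
    "(nat \<Rightarrow> 'r atom) \<Rightarrow> ('r, 'a) relstruct \<Rightarrow> ('r, 'b) relstruct \<Rightarrow> countable_ordinal \<Rightarrow>
      'a list \<Rightarrow> 'b list \<Rightarrow> bool"
  and bf_ge ::
    "(nat \<Rightarrow> 'r atom) \<Rightarrow> ('r, 'a) relstruct \<Rightarrow> ('r, 'b) relstruct \<Rightarrow> countable_ordinal \<Rightarrow>
      'a list \<Rightarrow> 'b list \<Rightarrow> bool"
  for e M N where
  le_0: "bf_0 e M N a b \<Longrightarrow> bf_le e M N 0 a b"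
| ge_0: "bf_0 e N M b a \<Longrightarrow> bf_ge e M N 0 a b"
| le_step: "0 < \<alpha> \<Longrightarrow>
    (\<And>\<beta> m d. \<beta> < \<alpha> \<Longrightarrow> d \<in> tuples N m \<Longrightarrow> \<exists>c\<in>tuples M m. bf_ge e M N \<beta> (a @ c) (b @ d)) \<Longrightarrow>
    bf_le e M N \<alpha> a b"
| ge_step: "0 < \<alpha> \<Longrightarrow>
    (\<And>\<beta> m c. \<beta> < \<alpha> \<Longrightarrow> c \<in> tuples M m \<Longrightarrow> \<exists>d\<in>tuples N m. bf_le e M N \<beta> (a @ c) (b @ d)) \<Longrightarrow>
    bf_ge e M N \<alpha> a b"

lemma bf_le_imp_ge: "bf_le e M N \<alpha> a b \<Longrightarrow> bf_ge e N M \<alpha> b a"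
  and bf_ge_imp_le: "bf_ge e M N \<alpha> a b \<Longrightarrow> bf_le e N M \<alpha> b a"
proof (induction rule: bf_le_bf_ge.inducts)
  case (le_step \<alpha> a b)
  show ?case by (rule bf_le_bf_ge.ge_step[OF le_step(1)]) (use le_step(2) in blast)
next
  case (ge_step \<alpha> a b)
  show ?case by (rule bf_le_bf_ge.le_step[OF ge_step(1)]) (use ge_step(2) in blast)
qed (auto intro: bf_le_bf_ge.intros)

lemma bf_ge_iff_le: "bf_ge e M N \<alpha> a b \<longleftrightarrow> bf_le e N M \<alpha> b a"
  using bf_ge_imp_le bf_le_imp_ge by blast

lemma bf_le_0: "bf_le e M N 0 a b \<longleftrightarrow> bf_0 e M N a b"
  by (auto intro: le_0 elim: bf_le.cases)

lemma bf_le_pos: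
  assumes "0 < \<alpha>"
  shows "bf_le e M N \<alpha> a b \<longleftrightarrow>
    (\<forall>\<beta><\<alpha>. \<forall>m. \<forall>d\<in>tuples N m. \<exists>c\<in>tuples M m. bf_le e N M \<beta> (b @ d) (a @ c))"
  using assms by (subst bf_le.simps) (auto simp: bf_ge_iff_le)

end

theory Submission
  imports Defs
begin

text \<open>\<open>N\<close> is the limit of a generic chain of finite tuples \<open>a\<^sub>0, a\<^sub>1, \<dots>\<close> of \<open>M\<close> such that \<open>a\<^sub>s\<close> is
  \<open>\<le>\<^sub>\<beta>\<^sub>s\<close> the initial segment of \<open>a\<^sub>s\<^sub>+\<^sub>1\<close>, where \<open>\<beta>\<^sub>s < \<alpha>\<close> is nondecreasing. Since \<open>x \<le>\<^sub>\<gamma>\<^sub>+\<^sub>1 y\<close> implies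
  \<open>y \<le>\<^sub>\<gamma> x\<close>, back-and-forth information above a stage at levels below \<open>\<beta>\<^sub>s\<close> survives to all later
  stages, so enough genericity gives \<open>(M, a\<^sub>s) \<le>\<^sub>\<beta>\<^sub>s (N, a\<^sub>s)\<close>; every \<open>\<Pi>\<^sub>\<beta>\<close> fact with \<open>\<beta> < \<alpha>\<close> can thus
  be made true in \<open>N\<close> by realizing it in \<open>M\<close>. This yields \<open>N \<le>\<^sub>\<alpha> M\<close>, and the truth of \<open>\<phi>\<close> by meeting
  one \<open>\<Sigma>\<^sub>\<alpha>\<close> instance at a time. As \<open>M\<close> is countable, the tuples of \<open>M\<close> lying \<open>\<ge>\<^sub>\<beta>\<close> a given one form a
  \<open>\<Pi>\<^sub>\<beta>\<close>-definable set, so a type that could not be refuted at some tuple of names would be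
  \<open>\<Sigma>\<^sub>\<alpha>\<close>-supported.\<close>


section \<open>Infinitary formulas\<close>

fun ren_atom :: "(nat \<Rightarrow> nat) \<Rightarrow> 'r atom \<Rightarrow> 'r atom" where
  "ren_atom f (Eq x y) = Eq (f x) (f y)"
| "ren_atom f (Rel R xs) = Rel R (map f xs)"

lemma atom_sat_ren_atom: "atom_sat M v (ren_atom f A) \<longleftrightarrow> atom_sat M (v \<circ> f) A"
  by (cases A) auto

lemma atom_vars_ren_atom: "atom_vars (ren_atom f A) = f ` atom_vars A"
  by (cases A) auto

lemma ren_atom_in_atoms: "A \<in> atoms L \<Longrightarrow> ren_atom f A \<in> atoms L"
  by (auto simp: atoms_def)

lemma ren_atom_id: "ren_atom id A = A"
  by (cases A) auto

lemma atom_sat_cong: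
  assumes "\<And>x. x \<in> atom_vars A \<Longrightarrow> v x = w x"
  shows "atom_sat M v A \<longleftrightarrow> atom_sat M w A"
proof (cases A)
  case (Rel R xs)
  then have "map v xs = map w xs" using assms by simp
  then show ?thesis using Rel by (simp del: map_eq_conv)
qed (use assms in auto)

lemma sat_cong: "(\<And>x. x \<in> fv \<phi> \<Longrightarrow> v x = w x) \<Longrightarrow> sat M \<phi> v \<longleftrightarrow> sat M \<phi> w"
proof (induction \<phi> arbitrary: v w)
  case (Atom A)
  then show ?case using atom_sat_cong[of A v w M] by simp
next
  case (Neg \<phi>)
  then show ?case by (metis fv.simps(2) sat.simps(2))
next
  case (Disj I f)
  have "sat M (f i) v \<longleftrightarrow> sat M (f i) w" if "i \<in> I" for i
  proof (rule Disj.IH)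
    show "v x = w x" if "x \<in> fv (f i)" for x using that \<open>i \<in> I\<close> Disj.prems by fastforce
  qed simp
  then show ?case by simp
next
  case (Conj I f)
  have "sat M (f i) v \<longleftrightarrow> sat M (f i) w" if "i \<in> I" for i
  proof (rule Conj.IH)
    show "v x = w x" if "x \<in> fv (f i)" for x using that \<open>i \<in> I\<close> Conj.prems by fastforce
  qed simp
  then show ?case by simp
next
  case (Exists x \<phi>)
  have "sat M \<phi> (v(x := d)) \<longleftrightarrow> sat M \<phi> (w(x := d))" for d
    using Exists by (intro Exists.IH) auto
  then show ?case by simp
next
  case (Forall x \<phi>)
  have "sat M \<phi> (v(x := d)) \<longleftrightarrow> sat M \<phi> (w(x := d))" for d
    using Forall by (intro Forall.IH) auto
  then show ?case by simp
qed

lemma fv_foldr_Exists: "fv (foldr Exists ys \<phi>) = fv \<phi> - set ys"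
  by (induction ys) auto

lemma fv_foldr_Forall: "fv (foldr Forall ys \<phi>) = fv \<phi> - set ys"
  by (induction ys) auto

lemma sat_foldr_Exists:
  "sat M (foldr Exists ys \<phi>) v \<longleftrightarrow>
    (\<exists>w. (\<forall>x. x \<notin> set ys \<longrightarrow> w x = v x) \<and> (\<forall>x\<in>set ys. w x \<in> universe M) \<and> sat M \<phi> w)"
proof (induction ys arbitrary: v)
  case Nil
  have "w = v" if "\<forall>x. w x = v x" for w using that by auto
  then show ?case by auto
next
  case (Cons y ys)
  show ?case
  proof
    assume "sat M (foldr Exists (y # ys) \<phi>) v"
    then obtain d w where "d \<in> universe M" "\<forall>x. x \<notin> set ys \<longrightarrow> w x = (v(y := d)) x"
      "\<forall>x\<in>set ys. w x \<in> universe M" "sat M \<phi> w"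
      using Cons.IH by auto
    then show "\<exists>w. (\<forall>x. x \<notin> set (y # ys) \<longrightarrow> w x = v x) \<and>
        (\<forall>x\<in>set (y # ys). w x \<in> universe M) \<and> sat M \<phi> w"
      by (intro exI[of _ w]) (auto split: if_splits)
  next
    assume "\<exists>w. (\<forall>x. x \<notin> set (y # ys) \<longrightarrow> w x = v x) \<and>
        (\<forall>x\<in>set (y # ys). w x \<in> universe M) \<and> sat M \<phi> w"
    then obtain w where "\<forall>x. x \<notin> set (y # ys) \<longrightarrow> w x = v x"
      "\<forall>x\<in>set (y # ys). w x \<in> universe M" "sat M \<phi> w" by blast
    then have "w y \<in> universe M" "sat M (foldr Exists ys \<phi>) (v(y := w y))"
      unfolding Cons.IH by auto
    then show "sat M (foldr Exists (y # ys) \<phi>) v" by auto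
  qed
qed

section \<open>Duality of \<Sigma> and \<Pi> formulas\<close>

primrec dual :: "'r fm \<Rightarrow> 'r fm" where
  "dual (Atom A) = Neg (Atom A)"
| "dual (Neg \<phi>) = \<phi>"
| "dual (Disj I f) = Conj I (\<lambda>i. dual (f i))"
| "dual (Conj I f) = Disj I (\<lambda>i. dual (f i))"
| "dual (Exists x \<phi>) = Forall x (dual \<phi>)"
| "dual (Forall x \<phi>) = Exists x (dual \<phi>)"

lemma sat_dual: "sat M (dual \<phi>) v \<longleftrightarrow> \<not> sat M \<phi> v"
  by (induction \<phi> arbitrary: v) auto

lemma fv_dual: "fv (dual \<phi>) = fv \<phi>"
  by (induction \<phi>) auto

lemma dual_foldr_Exists: "dual (foldr Exists ys \<phi>) = foldr Forall ys (dual \<phi>)"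
  by (induction ys) auto

lemma dual_foldr_Forall: "dual (foldr Forall ys \<phi>) = foldr Exists ys (dual \<phi>)"
  by (induction ys) auto

lemma sat_foldr_Forall:
  "sat M (foldr Forall ys \<phi>) v \<longleftrightarrow>
    (\<forall>w. (\<forall>x. x \<notin> set ys \<longrightarrow> w x = v x) \<longrightarrow> (\<forall>x\<in>set ys. w x \<in> universe M) \<longrightarrow> sat M \<phi> w)"
  using sat_dual[of M "foldr Forall ys \<phi>" v]
  by (auto simp: dual_foldr_Forall sat_foldr_Exists sat_dual)

lemma finitary_qf_dual: "finitary_qf L \<phi> \<Longrightarrow> finitary_qf L (dual \<phi>)"
  by (induction rule: finitary_qf.induct) (auto intro: finitary_qf.intros)

text \<open>No formula of positive level starts with \<open>Neg\<close>, so a negation has to be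
  pushed inwards; each member of the disjunction or conjunction keeps its variables and its
  level.\<close>

lemma is_Pi_dual: "is_Sigma L \<alpha> \<phi> \<Longrightarrow> is_Pi L \<alpha> (dual \<phi>)"
  and is_Sigma_dual: "is_Pi L \<alpha> \<phi> \<Longrightarrow> is_Sigma L \<alpha> (dual \<phi>)"
proof (induction rule: is_Sigma_is_Pi.inducts)
  case (Sigma \<alpha> I f ys \<psi> \<beta>)
  show ?case unfolding dual.simps
    by (rule is_Sigma_is_Pi.Pi[where ys = ys and \<psi> = "\<lambda>i. dual (\<psi> i)" and \<beta> = \<beta>])
      (use Sigma in \<open>auto simp: dual_foldr_Exists\<close>)
next
  case (Pi \<alpha> I f ys \<psi> \<beta>)
  show ?case unfolding dual.simps
    by (rule is_Sigma_is_Pi.Sigma[where ys = ys and \<psi> = "\<lambda>i. dual (\<psi> i)" and \<beta> = \<beta>])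
      (use Pi in \<open>auto simp: dual_foldr_Forall\<close>)
qed (auto intro: is_Sigma_is_Pi.intros finitary_qf_dual)

primrec fm_atoms :: "'r fm \<Rightarrow> 'r atom set" where
  "fm_atoms (Atom A) = {A}"
| "fm_atoms (Neg \<phi>) = fm_atoms \<phi>"
| "fm_atoms (Disj I f) = (\<Union>i\<in>I. fm_atoms (f i))"
| "fm_atoms (Conj I f) = (\<Union>i\<in>I. fm_atoms (f i))"
| "fm_atoms (Exists x \<phi>) = fm_atoms \<phi>"
| "fm_atoms (Forall x \<phi>) = fm_atoms \<phi>"

lemma finite_fm_atoms: "finitary_qf L \<phi> \<Longrightarrow> finite (fm_atoms \<phi>)"
  by (induction rule: finitary_qf.induct) auto

lemma fm_atoms_subset_atoms: "finitary_qf L \<phi> \<Longrightarrow> fm_atoms \<phi> \<subseteq> atoms L"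
  by (induction rule: finitary_qf.induct) auto

lemma atom_vars_subset_fv:
  "finitary_qf L \<phi> \<Longrightarrow> A \<in> fm_atoms \<phi> \<Longrightarrow> atom_vars A \<subseteq> fv \<phi>"
  by (induction rule: finitary_qf.induct) auto

lemma sat_finitary_qf_cong:
  "finitary_qf L \<phi> \<Longrightarrow> (\<And>A. A \<in> fm_atoms \<phi> \<Longrightarrow> atom_sat M v A \<longleftrightarrow> atom_sat N w A) \<Longrightarrow>
    sat M \<phi> v \<longleftrightarrow> sat N \<phi> w"
proof (induction rule: finitary_qf.induct)
  case (3 I f)
  then have "sat M (f i) v \<longleftrightarrow> sat N (f i) w" if "i \<in> I" for i using that by fastforce
  then show ?case by simp
next
  case (4 I f)
  then have "sat M (f i) v \<longleftrightarrow> sat N (f i) w" if "i \<in> I" for i using that by fastforce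
  then show ?case by simp
qed auto

lemma is_Pi_0_iff: "is_Pi L 0 \<phi> \<longleftrightarrow> finitary_qf L \<phi>"
  by (auto intro: Pi_0 elim: is_Pi.cases)

lemma is_Sigma_0_iff: "is_Sigma L 0 \<phi> \<longleftrightarrow> finitary_qf L \<phi>"
  by (auto intro: Sigma_0 elim: is_Sigma.cases)

lemma is_Pi_posD:
  assumes "is_Pi L \<alpha> \<phi>" "0 < \<alpha>"
  shows "\<exists>I f. \<phi> = Conj I f \<and>
    (\<forall>i\<in>I. \<exists>ys \<psi> \<beta>. f i = foldr Forall ys \<psi> \<and> \<beta> < \<alpha> \<and> is_Sigma L \<beta> \<psi>)"
  using assms by (cases rule: is_Pi.cases) (blast | simp)+

lemma is_Sigma_posD:
  assumes "is_Sigma L \<alpha> \<phi>" "0 < \<alpha>"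
  shows "\<exists>I f. \<phi> = Disj I f \<and>
    (\<forall>i\<in>I. \<exists>ys \<psi> \<beta>. f i = foldr Exists ys \<psi> \<and> \<beta> < \<alpha> \<and> is_Pi L \<beta> \<psi>)"
  using assms by (cases rule: is_Sigma.cases) (blast | simp)+

lemma is_Pi_countable_conj:
  assumes "0 < \<alpha>" "countable S"
    and S: "\<And>\<chi>. \<chi> \<in> S \<Longrightarrow> \<exists>ys \<psi> \<beta>. \<chi> = foldr Forall ys \<psi> \<and> \<beta> < \<alpha> \<and> is_Sigma L \<beta> \<psi>"
  obtains \<Theta> where "is_Pi L \<alpha> \<Theta>" "fv \<Theta> = (\<Union>\<chi>\<in>S. fv \<chi>)"
    "\<And>v. sat M \<Theta> v \<longleftrightarrow> (\<forall>\<chi>\<in>S. sat M \<chi> v)"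
proof -
  let ?I = "to_nat_on S ` S" and ?f = "from_nat_into S"
  have f: "?f (to_nat_on S \<chi>) = \<chi>" if "\<chi> \<in> S" for \<chi>
    using that assms(2) by simp
  have "\<exists>ys \<psi> \<beta>. ?f i = foldr Forall ys \<psi> \<and> \<beta> < \<alpha> \<and> is_Sigma L \<beta> \<psi>" if "i \<in> ?I" for i
    using that S f by auto
  then obtain ys \<psi> \<beta> where
    "\<And>i. i \<in> ?I \<Longrightarrow> ?f i = foldr Forall (ys i) (\<psi> i) \<and> \<beta> i < \<alpha> \<and> is_Sigma L (\<beta> i) (\<psi> i)"
    by metis
  then have "is_Pi L \<alpha> (Conj ?I ?f)" by (rule Pi[OF assms(1)])
  then show ?thesis by (rule that) (auto simp: f)
qed


section \<open>Back-and-forth relations on valuations\<close>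

definition vals :: "('r, 'a) relstruct \<Rightarrow> (nat \<Rightarrow> 'a) set" where
  "vals M = {v. range v \<subseteq> universe M}"

lemma vals_iff: "v \<in> vals M \<longleftrightarrow> (\<forall>x. v x \<in> universe M)"
  by (auto simp: vals_def)

lemma vals_comp: "v \<in> vals M \<Longrightarrow> v \<circ> f \<in> vals M"
  by (simp add: vals_iff)

locale enumerated_structure =
  fixes L :: "'r language" and e :: "nat \<Rightarrow> 'r atom" and M :: "('r, 'a) relstruct"
  assumes range_e: "range e = atoms L"
    and universe_nonempty: "universe M \<noteq> {}"
    and countable_universe: "countable (universe M)"
begin

section \<open>Finite bounds for positions in the enumeration of the atomic formulas\<close>

lemma e_in_atoms: "e i \<in> atoms L"
  using range_e by auto

lemma finite_atoms_bound:
  assumes "finite G" "G \<subseteq> atoms L"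
  obtains m where "G \<subseteq> e ` {..<m}"
proof -
  from assms obtain C where "finite C" "G = e ` C"
    using finite_subset_image[of G e UNIV] range_e by auto
  moreover obtain m where "C \<subseteq> {..<m}" using \<open>finite C\<close> finite_nat_iff_bounded by blast
  ultimately show thesis using that by blast
qed

lemma ren_atoms_bound: obtains m where "ren_atom f ` e ` {..<k} \<subseteq> e ` {..<m}"
proof -
  have "ren_atom f ` e ` {..<k} \<subseteq> atoms L" using ren_atom_in_atoms e_in_atoms by auto
  then show thesis using finite_atoms_bound that by (metis finite_imageI finite_lessThan)
qed

lemma qf_atoms_bound: obtains m where "finitary_qf L \<chi> \<longrightarrow> fm_atoms \<chi> \<subseteq> e ` {..<m}"
  using finite_atoms_bound[OF finite_fm_atoms[of L \<chi>] fm_atoms_subset_atoms[of L \<chi>]] by metis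

text \<open>Renaming moves an atomic formula to another place in the enumeration. This bound lets
  information on the first \<open>m\<close> atomic formulas over \<open>D\<close> decide the first
  \<open>r\<close> ones at any choice of names from \<open>D\<close>.\<close>

definition covers :: "nat \<Rightarrow> nat set \<Rightarrow> nat \<Rightarrow> bool" where
  "covers r D m \<longleftrightarrow> (\<forall>A\<in>e ` {..<r}. \<forall>f. f ` atom_vars A \<subseteq> D \<longrightarrow> ren_atom f A \<in> e ` {..<m})"

text \<open>A renaming of an atomic formula depends only on its finitely many variables, so a finite
  \<open>D\<close> allows finitely many results.\<close>

lemma ex_covers:
  assumes "finite D"
  shows "\<exists>m. covers r D m"
proof -
  define G where "G = (\<Union>A\<in>e ` {..<r}. {ren_atom f A | f. f ` atom_vars A \<subseteq> D})"
  have "finite {ren_atom f A | f. f ` atom_vars A \<subseteq> D}" for A :: "'r atom"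
  proof (cases A)
    case (Eq x y)
    then have "{ren_atom f A | f. f ` atom_vars A \<subseteq> D} \<subseteq> (\<lambda>(x, y). Eq x y) ` (D \<times> D)" by auto
    then show ?thesis using assms finite_subset by fast
  next
    case (Rel R xs)
    then have "{ren_atom f A | f. f ` atom_vars A \<subseteq> D} \<subseteq>
        Rel R ` {ys. set ys \<subseteq> D \<and> length ys = length xs}" by auto
    then show ?thesis using finite_lists_length_eq[OF assms] finite_subset by fast
  qed
  then have "finite G" unfolding G_def by auto
  moreover have "G \<subseteq> atoms L" using ren_atom_in_atoms e_in_atoms by (auto simp: G_def)
  ultimately obtain m where "G \<subseteq> e ` {..<m}" using finite_atoms_bound by blast
  then have "covers r D m" unfolding covers_def G_def by blast
  then show ?thesis ..
qed

lemma covers_mono: "covers r D m \<Longrightarrow> m \<le> m' \<Longrightarrow> covers r D m'"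
  unfolding covers_def by (meson image_mono lessThan_subset_iff subsetD)

text \<open>Valuations instead of tuples: names are never shifted when the domain \<open>D\<close> is enlarged. As
  every level \<open>\<gamma> < \<beta>\<close> quantifies over \<open>m'\<close>, the bound \<open>m\<close> on the atomic formulas matters only for
  \<open>\<beta> = 0\<close>.\<close>

function bfv :: "countable_ordinal \<Rightarrow> nat set \<Rightarrow> nat \<Rightarrow> (nat \<Rightarrow> 'a) \<Rightarrow> (nat \<Rightarrow> 'a) \<Rightarrow> bool" where
  "bfv \<beta> D m v w \<longleftrightarrow>
    (\<forall>i<m. atom_vars (e i) \<subseteq> D \<longrightarrow> (atom_sat M v (e i) \<longleftrightarrow> atom_sat M w (e i))) \<and>
    (\<forall>\<gamma>. \<gamma> < \<beta> \<longrightarrow> (\<forall>D' m'. \<forall>w'\<in>vals M. finite D' \<longrightarrow> D \<subseteq> D' \<longrightarrow> (\<forall>x\<in>D. w' x = w x) \<longrightarrow>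
      (\<exists>v'\<in>vals M. (\<forall>x\<in>D. v' x = v x) \<and> bfv \<gamma> D' m' w' v')))"
  by pat_completeness auto
termination
  by (relation "inv_image {(x, y). x < y} fst") (auto simp: wf wf_inv_image)

declare bfv.simps [simp del]

section \<open>Preorder properties and renaming for \<open>bfv\<close>\<close>

lemma bfv_atom:
  "bfv \<beta> D m v w \<Longrightarrow> i < m \<Longrightarrow> atom_vars (e i) \<subseteq> D \<Longrightarrow>
    atom_sat M v (e i) \<longleftrightarrow> atom_sat M w (e i)"
  by (subst (asm) bfv.simps) blast

lemma bfv_forth:
  assumes "bfv \<beta> D m v w" "\<gamma> < \<beta>" "w' \<in> vals M" "finite D'" "D \<subseteq> D'" "\<And>x. x \<in> D \<Longrightarrow> w' x = w x"
  obtains v' where "v' \<in> vals M" "\<And>x. x \<in> D \<Longrightarrow> v' x = v x" "bfv \<gamma> D' m' w' v'"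
proof -
  have "\<exists>v'\<in>vals M. (\<forall>x\<in>D. v' x = v x) \<and> bfv \<gamma> D' m' w' v'"
    using assms(1)[unfolded bfv.simps[of \<beta>]] assms(2-6) by blast
  then show thesis using that by blast
qed

lemma bfvI:
  assumes "\<And>i. i < m \<Longrightarrow> atom_vars (e i) \<subseteq> D \<Longrightarrow> atom_sat M v (e i) \<longleftrightarrow> atom_sat M w (e i)"
    and "\<And>\<gamma> D' m' w'. \<gamma> < \<beta> \<Longrightarrow> w' \<in> vals M \<Longrightarrow> finite D' \<Longrightarrow> D \<subseteq> D' \<Longrightarrow> \<forall>x\<in>D. w' x = w x \<Longrightarrow>
      \<exists>v'\<in>vals M. (\<forall>x\<in>D. v' x = v x) \<and> bfv \<gamma> D' m' w' v'"
  shows "bfv \<beta> D m v w"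
  using assms by (subst bfv.simps) blast

lemma bfv_cong:
  assumes "bfv \<beta> D m v w" "\<And>x. x \<in> D \<Longrightarrow> v x = v' x" "\<And>x. x \<in> D \<Longrightarrow> w x = w' x"
  shows "bfv \<beta> D m v' w'"
proof (rule bfvI)
  fix i assume i: "i < m" "atom_vars (e i) \<subseteq> D"
  have "atom_sat M v (e i) \<longleftrightarrow> atom_sat M v' (e i)" "atom_sat M w (e i) \<longleftrightarrow> atom_sat M w' (e i)"
    using assms(2,3) i by (auto intro!: atom_sat_cong)
  then show "atom_sat M v' (e i) \<longleftrightarrow> atom_sat M w' (e i)" using bfv_atom[OF assms(1) i] by simp
next
  fix \<gamma> D' m' u assume u: "\<gamma> < \<beta>" "u \<in> vals M" "finite D'" "D \<subseteq> D'" "\<forall>x\<in>D. u x = w' x"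
  obtain u' where "u' \<in> vals M" "\<And>x. x \<in> D \<Longrightarrow> u' x = v x" "bfv \<gamma> D' m' u u'"
    by (rule bfv_forth[OF assms(1) u(1-4)]) (use u(5) assms(3) in auto)
  then show "\<exists>u'\<in>vals M. (\<forall>x\<in>D. u' x = v' x) \<and> bfv \<gamma> D' m' u u'" using assms(2) by auto
qed

lemma bfv_refl: "v \<in> vals M \<Longrightarrow> bfv \<beta> D m v v"
proof (induction \<beta> arbitrary: D m v rule: less_induct)
  case (less \<beta>)
  show ?case by (rule bfvI) (use less in auto)
qed

lemma bfv_refl_on:
  assumes "v \<in> vals M" "\<And>x. x \<in> D \<Longrightarrow> v x = w x"
  shows "bfv \<beta> D m v w"
  by (rule bfv_cong[OF bfv_refl[OF assms(1)]]) (use assms(2) in auto)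

lemma bfv_trans: "bfv \<beta> D m u v \<Longrightarrow> bfv \<beta> D m v w \<Longrightarrow> bfv \<beta> D m u w"
proof (induction \<beta> arbitrary: D m u v w rule: less_induct)
  case (less \<beta>)
  show ?case
  proof (rule bfvI)
    fix \<gamma> D' m' w' assume w': "\<gamma> < \<beta>" "w' \<in> vals M" "finite D'" "D \<subseteq> D'" "\<forall>x\<in>D. w' x = w x"
    obtain v' where v': "v' \<in> vals M" "\<And>x. x \<in> D \<Longrightarrow> v' x = v x" "bfv \<gamma> D' m' w' v'"
      by (rule bfv_forth[OF less.prems(2) w'(1-4)]) (use w'(5) in auto)
    obtain u' where u': "u' \<in> vals M" "\<And>x. x \<in> D \<Longrightarrow> u' x = u x" "bfv \<gamma> D' m' v' u'"
      by (rule bfv_forth[OF less.prems(1) w'(1) v'(1) w'(3,4)]) (use v'(2) in auto)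
    then show "\<exists>u'\<in>vals M. (\<forall>x\<in>D. u' x = u x) \<and> bfv \<gamma> D' m' w' u'"
      using less.IH[OF w'(1) v'(3) u'(3)] by blast
  qed (use bfv_atom less.prems in blast)
qed

lemma bfv_mono: "bfv \<beta> D m v w \<Longrightarrow> \<gamma> \<le> \<beta> \<Longrightarrow> bfv \<gamma> D m v w"
  unfolding bfv.simps[of \<beta>] bfv.simps[of \<gamma>] using less_le_trans[of _ \<gamma> \<beta>] by auto

text \<open>The challenge is \<open>w\<close> itself over the unchanged \<open>D\<close>, and the
  answer agrees with \<open>v\<close> there. The bound \<open>m'\<close> is free because a challenge
  may name any bound.\<close>

lemma bfv_reverse:
  assumes "bfv \<beta> D m v w" "\<gamma> < \<beta>" "w \<in> vals M" "finite D"
  shows "bfv \<gamma> D m' w v"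
proof -
  obtain v' where "\<And>x. x \<in> D \<Longrightarrow> v' x = v x" "bfv \<gamma> D m' w v'"
    by (rule bfv_forth[OF assms]) auto
  then show ?thesis by (auto intro: bfv_cong)
qed

text \<open>A challenge to \<open>w \<circ> f\<close> becomes a challenge to \<open>w\<close> once
  the additional names of \<open>D''\<close> are moved off \<open>D\<close>; the answer is read back
  along the same renaming.\<close>

lemma bfv_reindex:
  assumes "bfv \<beta> D m v w" "v \<in> vals M" "w \<in> vals M" "finite D" "finite D'" "f ` D' \<subseteq> D"
    and "\<And>i. i < m' \<Longrightarrow> atom_vars (e i) \<subseteq> D' \<Longrightarrow> ren_atom f (e i) \<in> e ` {..<m}"
  shows "bfv \<beta> D' m' (v \<circ> f) (w \<circ> f)"
  using assms
proof (induction \<beta> arbitrary: D m v w D' m' f rule: less_induct)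
  case (less \<beta>)
  show ?case
  proof (rule bfvI)
    fix i assume i: "i < m'" "atom_vars (e i) \<subseteq> D'"
    then obtain j where j: "ren_atom f (e i) = e j" "j < m" using less.prems(7) by blast
    moreover have "atom_vars (e j) \<subseteq> D"
      using j(1) i(2) less.prems(6) by (metis atom_vars_ren_atom image_mono order_trans)
    ultimately show "atom_sat M (v \<circ> f) (e i) \<longleftrightarrow> atom_sat M (w \<circ> f) (e i)"
      using bfv_atom[OF less.prems(1)] by (metis atom_sat_ren_atom)
  next
    fix \<gamma> D'' m'' w'
    assume w': "\<gamma> < \<beta>" "w' \<in> vals M" "finite D''" "D' \<subseteq> D''" "\<forall>x\<in>D'. w' x = (w \<circ> f) x"
    \<comment> \<open>\<open>K\<close> bounds \<open>D\<close>, so the names \<open>K + x\<close>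
      are fresh. \<open>u\<close> is \<open>w\<close> on \<open>D\<close> and carries
      \<open>w'\<close> on the fresh names, which makes \<open>u \<circ> g\<close> equal to
      \<open>w'\<close> on \<open>D''\<close>.\<close>
    obtain K where K: "D \<subseteq> {..<K}" using less.prems(4) finite_nat_iff_bounded by blast
    define g where "g = (\<lambda>x. if x \<in> D' then f x else K + x)"
    define u where "u = (\<lambda>y. if y \<in> D then w y else w' (y - K))"
    obtain m0 where m0: "ren_atom g ` e ` {..<m''} \<subseteq> e ` {..<m0}" using ren_atoms_bound .
    have u: "u \<in> vals M" using less.prems(3) w'(2) by (auto simp: vals_iff u_def)
    have ug: "(u \<circ> g) x = w' x" if "x \<in> D''" for x
      using that w'(5) K less.prems(6) by (auto simp: u_def g_def subset_iff)
    obtain v' where v': "v' \<in> vals M" "\<And>x. x \<in> D \<Longrightarrow> v' x = v x" "bfv \<gamma> (D \<union> g ` D'') m0 u v'"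
      by (rule bfv_forth[OF less.prems(1) w'(1) u, of "D \<union> g ` D''" m0])
        (use less.prems(4) w'(3) in \<open>auto simp: u_def\<close>)
    have "bfv \<gamma> D'' m'' (u \<circ> g) (v' \<circ> g)"
      by (rule less.IH[OF w'(1) v'(3) u v'(1)]) (use m0 less.prems(4) w'(3) in auto)
    then have "bfv \<gamma> D'' m'' w' (v' \<circ> g)" by (rule bfv_cong) (use ug in auto)
    moreover have "\<forall>x\<in>D'. (v' \<circ> g) x = (v \<circ> f) x"
      using v'(2) less.prems(6) by (auto simp: g_def)
    ultimately show "\<exists>v'\<in>vals M. (\<forall>x\<in>D'. v' x = (v \<circ> f) x) \<and> bfv \<gamma> D'' m'' w' v'"
      using vals_comp[OF v'(1)] by blast
  qed
qed

lemma bfv_restrict: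
  assumes "bfv \<beta> D m v w" "v \<in> vals M" "w \<in> vals M" "finite D" "D' \<subseteq> D" "m' \<le> m"
  shows "bfv \<beta> D' m' v w"
  using bfv_reindex[OF assms(1-4), of D' id m'] assms(4-6) finite_subset
  by (auto simp: ren_atom_id)

section \<open>Definability of the tuples above a given one\<close>

definition elem :: 'a where
  "elem = (SOME u. u \<in> universe M)"

lemma elem_in_universe: "elem \<in> universe M"
  unfolding elem_def using universe_nonempty by (simp add: some_in_eq)

text \<open>There may be uncountably many valuations, but only countably many lists. On a finite set
  of names each valuation in \<open>vals M\<close> agrees with some
  \<open>list_val l\<close>.\<close>

definition list_val :: "'a list \<Rightarrow> nat \<Rightarrow> 'a" where
  "list_val l x = (if x < length l then l ! x else elem)"

lemma list_val_in_vals: "set l \<subseteq> universe M \<Longrightarrow> list_val l \<in> vals M"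
  using elem_in_universe by (auto simp: vals_iff list_val_def subset_iff)

lemma list_val_map: "x < k \<Longrightarrow> list_val (map v [0..<k]) x = v x"
  by (simp add: list_val_def)

text \<open>Definability uses that \<open>M\<close> is countable: \<open>bfv \<beta> D m v w\<close> fails above the atomic level exactly
  if some extension \<open>w'\<close> of \<open>w\<close> is not matched by any extension of \<open>v\<close>, and there are only countably
  many \<open>w'\<close> whose \<open>\<Pi>\<^sub>\<gamma>\<close> descriptions have to be forbidden.\<close>

lemma bfv_definable:
  assumes "v \<in> vals M" "finite D"
  shows "\<exists>\<Theta>. is_Pi L \<beta> \<Theta> \<and> fv \<Theta> \<subseteq> D \<and> (\<forall>w\<in>vals M. sat M \<Theta> w \<longleftrightarrow> bfv \<beta> D m v w)"
  using assms
proof (induction \<beta> arbitrary: D m v rule: less_induct)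
  case (less \<beta>)
  \<comment> \<open>The atomic part is the whole formula at level 0, and one conjunct with an empty
    quantifier block at higher levels.\<close>
  define lits where "lits = Conj {i. i < m \<and> atom_vars (e i) \<subseteq> D}
    (\<lambda>i. if atom_sat M v (e i) then Atom (e i) else Neg (Atom (e i)))"
  have lits_qf: "finitary_qf L lits"
    unfolding lits_def by (auto intro!: finitary_qf.intros simp: e_in_atoms)
  have lits_fv: "fv lits \<subseteq> D" by (auto simp: lits_def split: if_splits)
  have lits_sat: "sat M lits w \<longleftrightarrow> (\<forall>i<m. atom_vars (e i) \<subseteq> D \<longrightarrow>
      (atom_sat M v (e i) \<longleftrightarrow> atom_sat M w (e i)))" for w
    by (auto simp: lits_def split: if_splits)
  show ?case
  proof (cases "\<beta> = 0")
    case True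
    have "bfv \<beta> D m v w \<longleftrightarrow> sat M lits w" for w
      unfolding lits_sat by (subst bfv.simps) (simp add: True leD zero_le_countable_ordinal)
    then show ?thesis using lits_qf lits_fv True by (auto intro: Pi_0)
  next
    case False
    then have pos: "0 < \<beta>" using zero_le_countable_ordinal[of \<beta>] by simp
    define X where "X = {..<\<beta>} \<times> {D' :: nat set. finite D'} \<times> (UNIV :: nat set) \<times> lists (universe M)"
    have "\<exists>\<Theta>. is_Pi L \<gamma> \<Theta> \<and> fv \<Theta> \<subseteq> D' \<and> (\<forall>w\<in>vals M. sat M \<Theta> w \<longleftrightarrow> bfv \<gamma> D' m' (list_val l) w)"
      if "(\<gamma>, D', m', l) \<in> X" for \<gamma> D' m' l
      using that list_val_in_vals[of l] by (intro less.IH) (auto simp: X_def)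
    then obtain T where T: "\<And>\<gamma> D' m' l. (\<gamma>, D', m', l) \<in> X \<Longrightarrow> is_Pi L \<gamma> (T \<gamma> D' m' l) \<and>
        fv (T \<gamma> D' m' l) \<subseteq> D' \<and>
        (\<forall>w\<in>vals M. sat M (T \<gamma> D' m' l) w \<longleftrightarrow> bfv \<gamma> D' m' (list_val l) w)"
      by metis
    \<comment> \<open>\<open>X\<close> codes the challenges, and \<open>bad\<close> marks those that
      no extension of \<open>v\<close> answers. For these, \<open>F\<close> states that no extension
      of the valuation at hand to \<open>D'\<close> lies above the challenge.\<close>
    define bad where "bad = (\<lambda>(\<gamma>, D', m', l). D \<subseteq> D' \<and>
        (\<forall>v'\<in>vals M. (\<forall>x\<in>D. v' x = v x) \<longrightarrow> \<not> bfv \<gamma> D' m' (list_val l) v'))"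
    define F where "F = (\<lambda>(\<gamma>, D', m', l).
        foldr Forall (sorted_list_of_set (D' - D)) (dual (T \<gamma> D' m' l)))"
    define S where "S = insert lits (F ` {q \<in> X. bad q})"
    have "countable X" unfolding X_def
      using countable_lessThan_countable_ordinal countable_Collect_finite countable_universe
      by (intro countable_SIGMA countable_lists) auto
    then have "countable S" unfolding S_def by auto
    moreover have "\<exists>ys \<psi> \<gamma>. \<chi> = foldr Forall ys \<psi> \<and> \<gamma> < \<beta> \<and> is_Sigma L \<gamma> \<psi>" if \<chi>: "\<chi> \<in> S" for \<chi>
    proof (cases "\<chi> = lits")
      case True
      then show ?thesis
        by (intro exI[of _ "[]"] exI[of _ lits] exI[of _ 0]) (auto simp: pos lits_qf Sigma_0)
    next
      case False
      then obtain \<gamma> D' m' l where q: "(\<gamma>, D', m', l) \<in> X" "\<chi> = F (\<gamma>, D', m', l)"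
        using \<chi> unfolding S_def by fast
      then have "\<gamma> < \<beta>" "is_Sigma L \<gamma> (dual (T \<gamma> D' m' l))"
        using T[OF q(1)] by (auto simp: X_def is_Sigma_dual)
      then show ?thesis using q(2) unfolding F_def by auto
    qed
    ultimately obtain \<Theta> where \<Theta>: "is_Pi L \<beta> \<Theta>" "fv \<Theta> = (\<Union>\<chi>\<in>S. fv \<chi>)"
      "\<And>v. sat M \<Theta> v \<longleftrightarrow> (\<forall>\<chi>\<in>S. sat M \<chi> v)"
      using is_Pi_countable_conj[OF pos, of S L M] by metis
    have "fv \<Theta> \<subseteq> D"
    proof -
      have "fv (F q) \<subseteq> D" if "q \<in> X" for q
      proof -
        obtain \<gamma> D' m' l where q: "q = (\<gamma>, D', m', l)" by (metis prod_cases4)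
        then have "finite D'" using that by (auto simp: X_def)
        then show ?thesis using T[of \<gamma> D' m' l] that q
          by (auto simp: F_def fv_foldr_Forall fv_dual)
      qed
      then show ?thesis unfolding \<Theta>(2) S_def using lits_fv by blast
    qed
    moreover have "sat M \<Theta> w \<longleftrightarrow> bfv \<beta> D m v w" if w: "w \<in> vals M" for w
    proof
      assume sat: "sat M \<Theta> w"
      show "bfv \<beta> D m v w"
      proof (rule bfvI)
        show "atom_sat M v (e i) \<longleftrightarrow> atom_sat M w (e i)" if "i < m" "atom_vars (e i) \<subseteq> D" for i
          using sat that lits_sat[of w] unfolding \<Theta>(3) S_def by auto
      next
        fix \<gamma> D' m' w'
        assume w': "\<gamma> < \<beta>" "w' \<in> vals M" "finite D'" "D \<subseteq> D'" "\<forall>x\<in>D. w' x = w x"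
        obtain K where K: "D' \<subseteq> {..<K}" using w'(3) finite_nat_iff_bounded by blast
        define l where "l = map w' [0..<K]"
        have l: "list_val l x = w' x" if "x \<in> D'" for x
          using that K by (auto simp: l_def list_val_map)
        have X: "(\<gamma>, D', m', l) \<in> X" using w'(1-3) by (auto simp: X_def l_def vals_iff)
        \<comment> \<open>\<open>u\<close> differs from \<open>w\<close> only on
          \<open>D' - D\<close>, as the block of \<open>F\<close> requires. It agrees with the
          challenge on \<open>D'\<close> and so refutes \<open>F\<close>; hence the challenge is not
          bad.\<close>
        define u where "u = (\<lambda>x. if x \<in> D' then w' x else w x)"
        have u: "u \<in> vals M" using w w'(2) by (auto simp: u_def vals_iff)
        have "bfv \<gamma> D' m' (list_val l) u"
          by (rule bfv_cong[OF bfv_refl[OF w'(2)]]) (use l in \<open>auto simp: u_def\<close>)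
        then have "sat M (T \<gamma> D' m' l) u" using T[OF X] u by blast
        then have "\<not> sat M (F (\<gamma>, D', m', l)) w"
          unfolding F_def using w'(2,3,5)
          by (auto simp: sat_foldr_Forall sat_dual u_def vals_iff intro!: exI[of _ u])
        then have "\<not> bad (\<gamma>, D', m', l)" using sat X unfolding \<Theta>(3) S_def by blast
        then obtain v' where v': "v' \<in> vals M" "\<forall>x\<in>D. v' x = v x" "bfv \<gamma> D' m' (list_val l) v'"
          using w'(4) unfolding bad_def by blast
        then have "bfv \<gamma> D' m' w' v'" using l by (auto intro: bfv_cong)
        then show "\<exists>v'\<in>vals M. (\<forall>x\<in>D. v' x = v x) \<and> bfv \<gamma> D' m' w' v'" using v' by blast
      qed
    next
      assume R: "bfv \<beta> D m v w"
      have "sat M (F q) w" if q: "q \<in> X" "bad q" for q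
      proof (rule ccontr)
        assume "\<not> sat M (F q) w"
        moreover obtain \<gamma> D' m' l where q': "q = (\<gamma>, D', m', l)" by (metis prod_cases4)
        moreover have D': "finite D'" "\<gamma> < \<beta>" "D \<subseteq> D'" using q q' by (auto simp: X_def bad_def)
        ultimately obtain u where u: "\<forall>x. x \<notin> D' - D \<longrightarrow> u x = w x"
          "\<forall>x\<in>D' - D. u x \<in> universe M" "sat M (T \<gamma> D' m' l) u"
          by (auto simp: F_def sat_foldr_Forall sat_dual)
        have uv: "u \<in> vals M" using u(1,2) w by (metis vals_iff)
        then have lu: "bfv \<gamma> D' m' (list_val l) u" using T[of \<gamma> D' m' l] q q' u(3) by blast
        \<comment> \<open>\<open>u\<close> extends \<open>w\<close> and lies above the coded
          challenge. An answer \<open>v'\<close> to \<open>u\<close> lies above \<open>u\<close>,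
          hence above the challenge, which contradicts badness.\<close>
        obtain v' where v': "v' \<in> vals M" "\<And>x. x \<in> D \<Longrightarrow> v' x = v x" "bfv \<gamma> D' m' u v'"
          by (rule bfv_forth[OF R D'(2) uv D'(1,3)]) (use u(1) in auto)
        show False using bfv_trans[OF lu v'(3)] v'(1,2) q(2) unfolding q' bad_def by blast
      qed
      moreover have "sat M lits w" using bfv_atom[OF R] by (simp add: lits_sat)
      ultimately show "sat M \<Theta> w" unfolding \<Theta>(3) S_def by blast
    qed
    ultimately show ?thesis using \<Theta>(1) by blast
  qed
qed

end


section \<open>Conditions\<close>

text \<open>A requirement relates a condition to its successor, since its demand may depend on the
  names present so far. The first component of \<open>prod_decode n\<close> selects the requirement
  for stage \<open>n\<close>, so each one is met at arbitrarily late stages.\<close>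

lemma generic_sequence:
  assumes "countable Q" "P p" "\<And>q p. q \<in> Q \<Longrightarrow> P p \<Longrightarrow> \<exists>p'. P p' \<and> E p p' \<and> q p p'" "Q \<noteq> {}"
  obtains s :: "nat \<Rightarrow> 'c" where "\<And>i. P (s i)" "\<And>i. E (s i) (s (Suc i))"
    "\<And>q i. q \<in> Q \<Longrightarrow> \<exists>j\<ge>i. q (s j) (s (Suc j))"
proof -
  let ?q = "\<lambda>n. from_nat_into Q (fst (prod_decode n))"
  obtain s where s: "\<And>n. P (s n)" "\<And>n. E (s n) (s (Suc n)) \<and> ?q n (s n) (s (Suc n))"
    using dependent_nat_choice[of "\<lambda>_. P" "\<lambda>n p p'. E p p' \<and> ?q n p p'"]
      assms(2,3) from_nat_into[OF assms(4)] by metis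
  have "\<exists>j\<ge>i. q (s j) (s (Suc j))" if "q \<in> Q" for q i
  proof (intro exI conjI)
    let ?j = "prod_encode (to_nat_on Q q, i)"
    show "i \<le> ?j" by (rule le_prod_encode_2)
    show "q (s ?j) (s (Suc ?j))" using s(2)[of ?j] that assms(1) by simp
  qed
  then show thesis using that s by blast
qed

type_synonym 'b cond = "nat \<times> (nat \<Rightarrow> 'b) \<times> countable_ordinal"

locale conditions = enumerated_structure L e M
  for L :: "'r language" and e :: "nat \<Rightarrow> 'r atom" and M :: "('r, 'a) relstruct" +
  fixes \<alpha> :: countable_ordinal
  assumes pos: "0 < \<alpha>"
begin

text \<open>A condition \<open>(k, v, \<beta>)\<close> promises \<open>(M, v 0, \<dots>, v (k - 1)) \<le>\<^sub>\<beta> (N, 0, \<dots>, k - 1)\<close>.\<close>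

fun cond :: "'a cond \<Rightarrow> bool" where
  "cond (k, v, \<beta>) \<longleftrightarrow> v \<in> vals M \<and> \<beta> < \<alpha>"

text \<open>Old names may change their values as long as the new tuple lies above the old one at the
  level promised earlier.\<close>

fun ext :: "'a cond \<Rightarrow> 'a cond \<Rightarrow> bool" where
  "ext (k, v, \<beta>) (k', v', \<beta>') \<longleftrightarrow> k \<le> k' \<and> \<beta> \<le> \<beta>' \<and> bfv \<beta> {..<k} k v v'"

lemma ext_refl: "cond p \<Longrightarrow> ext p p"
  by (cases p) (auto intro: bfv_refl)

lemma ext_trans:
  assumes "cond p" "cond q" "cond r" "ext p q" "ext q r"
  shows "ext p r"
proof -
  obtain k v \<beta> k' v' \<beta>' k'' v'' \<beta>'' where
    pqr: "p = (k, v, \<beta>)" "q = (k', v', \<beta>')" "r = (k'', v'', \<beta>'')" by (metis prod_cases3)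
  have "bfv \<beta> {..<k'} k' v' v''" using assms pqr by (auto intro: bfv_mono)
  then have "bfv \<beta> {..<k} k v' v''"
    by (rule bfv_restrict) (use assms pqr in auto)
  then show ?thesis using assms pqr by (auto intro: bfv_trans)
qed

text \<open>Levels up to \<open>\<beta>\<close> are those that the promise transfers to the limit.
  The atomic formulas of a finitary quantifier-free formula must also lie among the first
  \<open>k\<close>, which \<open>ext\<close> preserves even when \<open>\<beta>\<close> is
  0.\<close>

fun Pi_forced :: "'r fm \<Rightarrow> (nat \<Rightarrow> nat) \<Rightarrow> 'a cond \<Rightarrow> bool" where
  "Pi_forced \<chi> \<sigma> (k, v, \<beta>) \<longleftrightarrow> (\<exists>\<delta>\<le>\<beta>. is_Pi L \<delta> \<chi>) \<and> \<sigma> ` fv \<chi> \<subseteq> {..<k} \<and>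
    (finitary_qf L \<chi> \<longrightarrow> ren_atom \<sigma> ` fm_atoms \<chi> \<subseteq> e ` {..<k}) \<and> sat M \<chi> (v \<circ> \<sigma>)"

text \<open>The first alternative serves level 0, where \<Sigma> and \<Pi> coincide. In the second,
  \<open>\<sigma>'\<close> names witnesses for one disjunct.\<close>

definition Sigma_forced :: "'r fm \<Rightarrow> (nat \<Rightarrow> nat) \<Rightarrow> 'a cond \<Rightarrow> bool" where
  "Sigma_forced \<psi> \<sigma> p \<longleftrightarrow> Pi_forced \<psi> \<sigma> p \<or>
    (\<exists>I f i ys \<chi> \<sigma>'. \<psi> = Disj I f \<and> i \<in> I \<and> f i = foldr Exists ys \<chi> \<and>
      (\<forall>x. x \<notin> set ys \<longrightarrow> \<sigma>' x = \<sigma> x) \<and> Pi_forced \<chi> \<sigma>' p)"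

text \<open>Old values stay as they are: witnesses receive fresh names, and \<open>k\<close> and
  \<open>\<beta>\<close> are raised as far as the chosen disjunct needs.\<close>

lemma ex_Sigma_forced:
  assumes "cond (k, v, \<beta>)" "is_Sigma L \<gamma> \<psi>" "\<gamma> \<le> \<alpha>" "\<sigma> ` fv \<psi> \<subseteq> {..<k}" "sat M \<psi> (v \<circ> \<sigma>)"
  shows "\<exists>p'. cond p' \<and> ext (k, v, \<beta>) p' \<and> Sigma_forced \<psi> \<sigma> p'"
proof (cases "\<gamma> = 0")
  case True
  then have qf: "finitary_qf L \<psi>" using assms(2) by (simp add: is_Sigma_0_iff)
  then have "finite (ren_atom \<sigma> ` fm_atoms \<psi>)" "ren_atom \<sigma> ` fm_atoms \<psi> \<subseteq> atoms L"
    using finite_fm_atoms fm_atoms_subset_atoms ren_atom_in_atoms by blast+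
  then obtain m where m: "ren_atom \<sigma> ` fm_atoms \<psi> \<subseteq> e ` {..<m}" using finite_atoms_bound by blast
  also have "\<dots> \<subseteq> e ` {..<max k m}" by auto
  finally have "Pi_forced \<psi> \<sigma> (max k m, v, \<beta>)"
    using assms(4,5) Pi_0[OF qf] zero_le_countable_ordinal[of \<beta>] by auto
  then show ?thesis unfolding Sigma_forced_def using assms(1)
    by (intro exI[of _ "(max k m, v, \<beta>)"]) (auto intro: bfv_refl)
next
  case False
  then have "0 < \<gamma>" using zero_le_countable_ordinal[of \<gamma>] by simp
  then obtain I f where \<psi>: "\<psi> = Disj I f" and
    "\<forall>i\<in>I. \<exists>ys \<psi> \<beta>. f i = foldr Exists ys \<psi> \<and> \<beta> < \<gamma> \<and> is_Pi L \<beta> \<psi>"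
    using is_Sigma_posD[OF assms(2)] by blast
  moreover obtain i where i: "i \<in> I" "sat M (f i) (v \<circ> \<sigma>)" using assms(5) \<psi> by auto
  ultimately obtain ys \<chi> \<delta> where \<chi>: "f i = foldr Exists ys \<chi>" "\<delta> < \<gamma>" "is_Pi L \<delta> \<chi>" by blast
  obtain w where w: "\<forall>x. x \<notin> set ys \<longrightarrow> w x = (v \<circ> \<sigma>) x" "\<forall>x\<in>set ys. w x \<in> universe M" "sat M \<chi> w"
    using i(2) unfolding \<chi>(1) sat_foldr_Exists by blast
  have w_vals: "w \<in> vals M" using w(1,2) assms(1) by (metis cond.simps vals_comp vals_iff)
  \<comment> \<open>The variable \<open>z\<close> of the block receives the name
    \<open>k + z\<close>, to which \<open>v'\<close> gives the witness \<open>w z\<close>.\<close>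
  define \<sigma>' where "\<sigma>' = (\<lambda>z. if z \<in> set ys then k + z else \<sigma> z)"
  define v' where "v' = (\<lambda>x. if x < k then v x else w (x - k))"
  have fv: "\<sigma> z < k" if "z \<in> fv \<chi>" "z \<notin> set ys" for z
  proof -
    have "z \<in> fv (f i)" using that by (simp add: \<chi>(1) fv_foldr_Exists)
    then show ?thesis using assms(4) i(1) \<psi> by auto
  qed
  obtain K where K: "set ys \<subseteq> {..<K}" using finite_nat_iff_bounded by blast
  obtain r where r: "finitary_qf L \<chi> \<longrightarrow> fm_atoms \<chi> \<subseteq> e ` {..<r}" by (rule qf_atoms_bound)
  obtain m where m: "ren_atom \<sigma>' ` e ` {..<r} \<subseteq> e ` {..<m}" by (rule ren_atoms_bound)
  define k' where "k' = max (k + K) m"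
  have "sat M \<chi> (v' \<circ> \<sigma>') \<longleftrightarrow> sat M \<chi> w"
    using fv w(1) by (intro sat_cong) (auto simp: \<sigma>'_def v'_def)
  moreover have "\<sigma>' ` fv \<chi> \<subseteq> {..<k'}"
    using fv K by (fastforce simp: \<sigma>'_def k'_def)
  moreover have "ren_atom \<sigma>' ` fm_atoms \<chi> \<subseteq> e ` {..<k'}" if "finitary_qf L \<chi>"
  proof -
    have "ren_atom \<sigma>' ` fm_atoms \<chi> \<subseteq> e ` {..<m}" using r m that by blast
    also have "\<dots> \<subseteq> e ` {..<k'}" by (auto simp: k'_def)
    finally show ?thesis .
  qed
  ultimately have "Pi_forced \<chi> \<sigma>' (k', v', max \<beta> \<delta>)"
    using \<chi>(3) w(3) by (auto intro!: exI[of _ \<delta>])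
  moreover have "\<forall>x. x \<notin> set ys \<longrightarrow> \<sigma>' x = \<sigma> x" by (simp add: \<sigma>'_def)
  ultimately have "Sigma_forced \<psi> \<sigma> (k', v', max \<beta> \<delta>)"
    unfolding Sigma_forced_def using \<psi> i(1) \<chi>(1) by blast
  moreover have "cond (k', v', max \<beta> \<delta>)"
    using assms(1,3) \<chi>(2) w_vals by (auto simp: vals_iff v'_def)
  moreover have "ext (k, v, \<beta>) (k', v', max \<beta> \<delta>)"
    using assms(1) by (auto simp: k'_def v'_def intro: bfv_refl_on)
  ultimately show ?thesis by blast
qed

text \<open>The requirement behind the step from \<open>M\<close> to the limit. If \<open>dl\<close>
  lies above the current values on \<open>D\<close> at some level beyond \<open>\<delta>\<close>,
  the further elements \<open>wl\<close> are matched by the names from \<open>k\<close> on, with the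
  tuple of \<open>M\<close> now lying below. Otherwise only growth and bounds are demanded.\<close>

fun realizes :: "nat set \<Rightarrow> 'a list \<Rightarrow> 'a list \<Rightarrow> nat \<Rightarrow> countable_ordinal \<Rightarrow> 'a cond \<Rightarrow> 'a cond \<Rightarrow> bool"
  where
  "realizes D dl wl r \<delta> (k, v, \<beta>) (k', v', \<beta>') \<longleftrightarrow> k < k' \<and> k + length wl \<le> k' \<and> \<delta> \<le> \<beta>' \<and>
    (D \<subseteq> {..<k} \<longrightarrow> covers r (D \<union> {k..<k + length wl}) k') \<and>
    (D \<subseteq> {..<k} \<longrightarrow> (\<exists>\<gamma>>\<delta>. \<exists>m. bfv \<gamma> D m v (list_val dl)) \<longrightarrow>
      bfv \<delta> (D \<union> {k..<k + length wl}) k'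
        (\<lambda>x. if x \<in> D then list_val dl x else list_val wl (x - k)) v')"

lemma ex_realizes:
  assumes "cond (k, v, \<beta>)" "set dl \<subseteq> universe M" "set wl \<subseteq> universe M" "\<delta> < \<alpha>"
  shows "\<exists>p'. cond p' \<and> ext (k, v, \<beta>) p' \<and> realizes D dl wl r \<delta> (k, v, \<beta>) p'"
proof -
  let ?D' = "D \<union> {k..<k + length wl}"
  let ?d = "\<lambda>x. if x \<in> D then list_val dl x else list_val wl (x - k)"
  have d: "?d \<in> vals M" using list_val_in_vals assms(2,3) by (auto simp: vals_iff)
  have "\<exists>m. D \<subseteq> {..<k} \<longrightarrow> covers r ?D' m"
    using ex_covers[of ?D' r] finite_subset by blast
  then obtain m where m: "D \<subseteq> {..<k} \<longrightarrow> covers r ?D' m" by blast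
  define k' where "k' = max (Suc k + length wl) m"
  have cov: "D \<subseteq> {..<k} \<longrightarrow> covers r ?D' k'" using m covers_mono[of r ?D' m k'] by (simp add: k'_def)
  show ?thesis
  proof (cases "D \<subseteq> {..<k} \<and> (\<exists>\<gamma>>\<delta>. \<exists>m. bfv \<gamma> D m v (list_val dl))")
    case True
    then obtain \<gamma> m' where \<gamma>: "\<delta> < \<gamma>" "bfv \<gamma> D m' v (list_val dl)" by blast
    have D: "finite ?D'" "D \<subseteq> ?D'" using True finite_subset by auto
    obtain u where u: "u \<in> vals M" "\<And>x. x \<in> D \<Longrightarrow> u x = v x" "bfv \<delta> ?D' k' ?d u"
      by (rule bfv_forth[OF \<gamma>(2,1) d D]) auto
    \<comment> \<open>The answer \<open>u\<close> matters only on \<open>D\<close> and the new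
      names. Names below \<open>k\<close> keep their values from \<open>v\<close>, with which
      \<open>u\<close> agrees on \<open>D\<close>, so the old promise holds by reflexivity.\<close>
    define v' where "v' = (\<lambda>x. if x < k then v x else u x)"
    have "bfv \<delta> ?D' k' ?d v'"
      by (rule bfv_cong[OF u(3)]) (use u(2) True in \<open>auto simp: v'_def\<close>)
    moreover have "bfv \<beta> {..<k} k v v'"
      using assms(1) by (auto simp: v'_def intro: bfv_refl_on)
    moreover have "v' \<in> vals M" using u(1) assms(1) by (auto simp: v'_def vals_iff)
    ultimately show ?thesis using cov assms(1,4)
      by (intro exI[of _ "(k', v', max \<beta> \<delta>)"]) (auto simp: k'_def)
  next
    case False
    then have "realizes D dl wl r \<delta> (k, v, \<beta>) (k', v, max \<beta> \<delta>)"
      using cov by (auto simp: k'_def)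
    then show ?thesis using assms(1,4)
      by (intro exI[of _ "(k', v, max \<beta> \<delta>)"]) (auto simp: k'_def intro: bfv_refl)
  qed
qed

section \<open>Refuting a type at a tuple of names\<close>

definition names :: "nat list \<Rightarrow> nat \<Rightarrow> nat" where
  "names xs x = (if x < length xs then xs ! x else 0)"

text \<open>The type is omitted at \<open>xs\<close> because "some \<open>k\<close>-tuple extending \<open>xs\<close> lies \<open>\<ge>\<^sub>\<beta>\<close> the current one"
  is a \<open>\<Sigma>\<^sub>\<alpha>\<close> formula satisfied in \<open>M\<close>, hence does not support the type. The variables \<open>n..<n + k\<close> of
  the formula stand for the names \<open>0..<k\<close>, the variables \<open>0..<n\<close> for \<open>xs\<close>.\<close>

lemma ex_omitting:
  assumes cnd: "cond (k, v, \<beta>)" and type: "Pi_type L \<alpha> n \<Gamma>"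
    and unsupported: "\<not> Sigma_supported L \<alpha> M n \<Gamma>"
    and xs: "length xs = n" "set xs \<subseteq> {..<k}"
  shows "\<exists>p'. cond p' \<and> ext (k, v, \<beta>) p' \<and> (\<exists>\<gamma>\<in>\<Gamma>. Sigma_forced (dual \<gamma>) (names xs) p')"
proof -
  have v: "v \<in> vals M" and \<beta>: "\<beta> < \<alpha>" using cnd by auto
  define u where "u = (\<lambda>y. if y < n then v (xs ! y) else v (y - n))"
  have u: "u \<in> vals M" using v by (auto simp: vals_iff u_def)
  \<comment> \<open>Two groups of atomic formulas must survive: the first \<open>k\<close>, shifted
    to the variables that stand for names, are needed for \<open>ext\<close>; the equations tie the
    variable \<open>j\<close> to its name \<open>xs ! j\<close>.\<close>
  define G where "G = ren_atom (\<lambda>x. x + n) ` e ` {..<k} \<union> (\<lambda>j. Eq j (xs ! j + n)) ` {..<n}"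
  have "finite G" unfolding G_def by auto
  moreover have "G \<subseteq> atoms L" unfolding G_def using ren_atom_in_atoms[OF e_in_atoms]
    by (auto simp: atoms_def)
  ultimately obtain m where m: "G \<subseteq> e ` {..<m}" using finite_atoms_bound by blast
  obtain \<Theta> where \<Theta>: "is_Pi L \<beta> \<Theta>" "fv \<Theta> \<subseteq> {..<n + k}"
    "\<And>w. w \<in> vals M \<Longrightarrow> sat M \<Theta> w \<longleftrightarrow> bfv \<beta> {..<n + k} m u w"
    using bfv_definable[OF u, of "{..<n + k}" \<beta> m] by auto
  define \<theta> where "\<theta> = Disj {0} (\<lambda>_. foldr Exists [n..<n + k] \<Theta>)"
  have "is_Sigma L \<alpha> \<theta>" unfolding \<theta>_def
    by (rule Sigma[OF pos, where ys = "\<lambda>_. [n..<n + k]" and \<psi> = "\<lambda>_. \<Theta>" and \<beta> = "\<lambda>_. \<beta>"])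
      (use \<Theta>(1) \<beta> in auto)
  moreover have "fv \<theta> \<subseteq> {..<n}" using \<Theta>(2) by (auto simp: \<theta>_def fv_foldr_Exists)
  moreover have "\<exists>a\<in>tuples M n. tuple_sat M a \<theta>"
  proof
    show "map v xs \<in> tuples M n" using v xs(1) by (auto simp: tuples_def vals_iff)
    let ?w = "\<lambda>y. if y < n + k then u y else map v xs ! y"
    have "sat M \<Theta> ?w \<longleftrightarrow> sat M \<Theta> u" by (rule sat_cong) (use \<Theta>(2) in auto)
    then have "sat M \<Theta> ?w" using \<Theta>(3)[OF u] bfv_refl[OF u] by simp
    moreover have "\<forall>x. x \<notin> set [n..<n + k] \<longrightarrow> ?w x = map v xs ! x"
      using xs(1) by (auto simp: u_def)
    moreover have "\<forall>x\<in>set [n..<n + k]. ?w x \<in> universe M"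
      using u by (auto simp: vals_iff)
    ultimately have "sat M (foldr Exists [n..<n + k] \<Theta>) ((!) (map v xs))"
      unfolding sat_foldr_Exists by (intro exI[of _ ?w] conjI)
    then show "tuple_sat M (map v xs) \<theta>" by (simp add: tuple_sat_def \<theta>_def)
  qed
  ultimately obtain a \<gamma> where a: "a \<in> tuples M n" "tuple_sat M a \<theta>" "\<gamma> \<in> \<Gamma>" "\<not> tuple_sat M a \<gamma>"
    using unsupported unfolding Sigma_supported_def by blast
  from a(2) obtain w0 where w0: "\<forall>x. x \<notin> set [n..<n + k] \<longrightarrow> w0 x = a ! x"
    "\<forall>x\<in>set [n..<n + k]. w0 x \<in> universe M" "sat M \<Theta> w0"
    by (auto simp: tuple_sat_def \<theta>_def sat_foldr_Exists)
  \<comment> \<open>Beyond \<open>n + k\<close>, \<open>w0\<close> takes the unspecified values of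
    \<open>(!) a\<close>, which may lie outside the universe; \<open>elem\<close> replaces
    them.\<close>
  define w where "w = (\<lambda>x. if x < n + k then w0 x else elem)"
  have wa: "w j = a ! j" if "j < n" for j using w0(1) that by (auto simp: w_def)
  have w: "w \<in> vals M"
    unfolding vals_iff
  proof
    fix x
    show "w x \<in> universe M"
      using wa[of x] a(1) w0(2) elem_in_universe by (cases "x < n") (auto simp: w_def tuples_def)
  qed
  have "sat M \<Theta> w \<longleftrightarrow> sat M \<Theta> w0" by (rule sat_cong) (use \<Theta>(2) in \<open>auto simp: w_def\<close>)
  then have R: "bfv \<beta> {..<n + k} m u w" using \<Theta>(3)[OF w] w0(3) by simp
  define v' where "v' = w \<circ> (\<lambda>x. x + n)"
  have v': "v' \<in> vals M" unfolding v'_def using w by (rule vals_comp)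
  have "bfv \<beta> {..<k} k (u \<circ> (\<lambda>x. x + n)) v'" unfolding v'_def
    by (rule bfv_reindex[OF R u w]) (use m in \<open>auto simp: G_def\<close>)
  moreover have "u \<circ> (\<lambda>x. x + n) = v" by (auto simp: u_def)
  ultimately have ext1: "ext (k, v, \<beta>) (k, v', \<beta>)" by simp
  \<comment> \<open>The equations in \<open>G\<close> hold at \<open>u\<close> and therefore at
    \<open>w\<close>: the tuple \<open>a\<close> consists of the new values of the names
    \<open>xs\<close>.\<close>
  have a_v': "a ! j = v' (xs ! j)" if j: "j < n" for j
  proof -
    have "Eq j (xs ! j + n) \<in> G" using j by (auto simp: G_def)
    then obtain i where i: "i < m" "e i = Eq j (xs ! j + n)" using m by fastforce
    have "xs ! j < k" using xs j by (auto simp: subset_iff)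
    then have "atom_vars (e i) \<subseteq> {..<n + k}" using i j by simp
    moreover have "u j = u (xs ! j + n)" using j by (simp add: u_def)
    ultimately have "w j = w (xs ! j + n)" using bfv_atom[OF R i(1)] i(2) by simp
    then show ?thesis using wa[OF j] by (simp add: v'_def)
  qed
  have \<gamma>: "is_Pi L \<alpha> \<gamma>" "fv \<gamma> \<subseteq> {..<n}" using type a(3) by (auto simp: Pi_type_def)
  have "sat M \<gamma> (v' \<circ> names xs) \<longleftrightarrow> tuple_sat M a \<gamma>" unfolding tuple_sat_def
    by (rule sat_cong) (use \<gamma>(2) a_v' xs(1) in \<open>auto simp: names_def\<close>)
  then have "sat M (dual \<gamma>) (v' \<circ> names xs)" using a(4) by (simp add: sat_dual)
  moreover have "names xs ` fv (dual \<gamma>) \<subseteq> {..<k}"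
    using \<gamma>(2) xs by (auto simp: fv_dual names_def subset_iff)
  moreover have cnd': "cond (k, v', \<beta>)" using v' \<beta> by simp
  ultimately obtain p' where p': "cond p'" "ext (k, v', \<beta>) p'" "Sigma_forced (dual \<gamma>) (names xs) p'"
    using ex_Sigma_forced[OF _ is_Sigma_dual[OF \<gamma>(1)]] by blast
  then show ?thesis using ext_trans[OF cnd cnd' p'(1) ext1 p'(2)] a(3) by blast
qed

end


section \<open>The limit structure\<close>

text \<open>Only the genericity needed to compare \<open>M\<close> with the limit is assumed. The
  requirements for the sentence and the types enter through
  \<open>Sigma_forced_limit\<close>.\<close>

locale generic_chain = conditions L e M \<alpha>
  for L :: "'r language" and e :: "nat \<Rightarrow> 'r atom" and M :: "('r, 'a) relstruct" and \<alpha> +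
  fixes k :: "nat \<Rightarrow> nat" and v :: "nat \<Rightarrow> nat \<Rightarrow> 'a" and \<beta> :: "nat \<Rightarrow> countable_ordinal"
  assumes cond_chain: "cond (k s, v s, \<beta> s)"
    and ext_Suc: "ext (k s, v s, \<beta> s) (k (Suc s), v (Suc s), \<beta> (Suc s))"
    and realizes_chain: "\<lbrakk>finite D; set dl \<subseteq> universe M; set wl \<subseteq> universe M; \<delta> < \<alpha>\<rbrakk> \<Longrightarrow>
      \<exists>t\<ge>s. realizes D dl wl r \<delta> (k t, v t, \<beta> t) (k (Suc t), v (Suc t), \<beta> (Suc t))"
begin

lemma v_vals: "v s \<in> vals M" and \<beta>_less: "\<beta> s < \<alpha>"
  using cond_chain[of s] by auto

lemma ext_chain: "s \<le> t \<Longrightarrow> ext (k s, v s, \<beta> s) (k t, v t, \<beta> t)"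
proof (induction t rule: dec_induct)
  case base
  show ?case by (rule ext_refl[OF cond_chain])
next
  case (step t)
  show ?case by (rule ext_trans[OF cond_chain cond_chain cond_chain step.IH ext_Suc])
qed

lemma
  assumes "s \<le> t"
  shows k_mono: "k s \<le> k t" and \<beta>_mono: "\<beta> s \<le> \<beta> t"
    and bfv_chain: "bfv (\<beta> s) {..<k s} (k s) (v s) (v t)"
  using ext_chain[OF assms] by auto

lemma k_unbounded: "\<exists>t\<ge>s. l \<le> k t"
proof (induction l)
  case (Suc l)
  then obtain t where "s \<le> t" "l \<le> k t" by blast
  \<comment> \<open>Even with empty data \<open>realizes\<close> demands that \<open>k\<close>
    grows.\<close>
  moreover obtain t' where "t \<le> t'" "k t' < k (Suc t')"
    using realizes_chain[of "{}" "[]" "[]" 0 t 0] pos by auto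
  ultimately show ?case using k_mono[of t t'] by (intro exI[of _ "Suc t'"]) auto
qed auto

section \<open>Names modulo eventual equality\<close>

definition holds :: "'r atom \<Rightarrow> bool" where
  "holds A \<longleftrightarrow> eventually (\<lambda>s. atom_sat M (v s) A) sequentially"

text \<open>The least equivalent name represents its class, so the limit lives on natural numbers
  and its elements are themselves names.\<close>

definition rep :: "nat \<Rightarrow> nat" where
  "rep x = (LEAST y. holds (Eq y x))"

definition N :: "('r, nat) relstruct" where
  "N = \<lparr>universe = range rep, interp = (\<lambda>R xs. holds (Rel R xs))\<rparr>"

lemma holds_stage:
  assumes "i < k s" "atom_vars (e i) \<subseteq> {..<k s}"
  shows "holds (e i) \<longleftrightarrow> atom_sat M (v s) (e i)"
proof -
  have "atom_sat M (v t) (e i) \<longleftrightarrow> atom_sat M (v s) (e i)" if "s \<le> t" for t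
    using bfv_atom[OF bfv_chain[OF that] assms] by simp
  then show ?thesis unfolding holds_def eventually_sequentially by (metis nle_le)
qed

lemma holds_rep: "holds (Eq (rep x) x)"
  unfolding rep_def by (rule LeastI[of _ x]) (simp add: holds_def)

lemma rep_eq_iff: "rep x = rep y \<longleftrightarrow> holds (Eq x y)"
proof
  assume "rep x = rep y"
  then have "eventually (\<lambda>s. v s (rep x) = v s x \<and> v s (rep x) = v s y) sequentially"
    using holds_rep[of x] holds_rep[of y] by (simp add: holds_def eventually_conj)
  then show "holds (Eq x y)"
    unfolding holds_def by (rule eventually_mono) auto
next
  assume xy: "holds (Eq x y)"
  have "holds (Eq z x) \<longleftrightarrow> holds (Eq z y)" for z
  proof
    assume "holds (Eq z x)"
    with xy show "holds (Eq z y)" unfolding holds_def by eventually_elim auto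
  next
    assume "holds (Eq z y)"
    with xy show "holds (Eq z x)" unfolding holds_def by eventually_elim auto
  qed
  then show "rep x = rep y" by (simp add: rep_def)
qed

lemma rep_universe: "x \<in> universe N \<Longrightarrow> rep x = x"
  using holds_rep rep_eq_iff by (auto simp: N_def)

lemma rep_in_universe: "rep x \<in> universe N"
  by (simp add: N_def)

text \<open>Finitely many names occur, so from some stage on all of them have the same values as
  their representatives.\<close>

lemma holds_Rel_rep: "holds (Rel R (map rep xs)) \<longleftrightarrow> holds (Rel R xs)"
proof -
  have "eventually (\<lambda>s. \<forall>x\<in>set xs. v s (rep x) = v s x) sequentially"
    using holds_rep by (intro eventually_ball_finite) (auto simp: holds_def)
  then have "eventually (\<lambda>s. map (v s) (map rep xs) = map (v s) xs) sequentially"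
    by (rule eventually_mono) auto
  then have "eventually (\<lambda>s. atom_sat M (v s) (Rel R (map rep xs)) \<longleftrightarrow>
      atom_sat M (v s) (Rel R xs)) sequentially"
    by (rule eventually_mono) (simp only: atom_sat.simps)
  then show ?thesis unfolding holds_def by (rule eventually_subst)
qed

lemma atom_sat_N: "atom_sat N (rep \<circ> \<sigma>) A \<longleftrightarrow> holds (ren_atom \<sigma> A)"
proof (cases A)
  case (Rel R xs)
  then show ?thesis using holds_Rel_rep[of R "map \<sigma> xs"] by (simp add: N_def)
qed (simp add: rep_eq_iff)

lemma atom_sat_N_stage:
  assumes "ren_atom \<sigma> A \<in> e ` {..<k s}" "\<sigma> ` atom_vars A \<subseteq> {..<k s}"
  shows "atom_sat N (rep \<circ> \<sigma>) A \<longleftrightarrow> atom_sat M (v s \<circ> \<sigma>) A"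
proof -
  obtain i where i: "i < k s" "ren_atom \<sigma> A = e i" using assms(1) by auto
  then have "atom_vars (e i) \<subseteq> {..<k s}" using assms(2) by (metis atom_vars_ren_atom)
  then show ?thesis using holds_stage[OF i(1)] i(2) by (metis atom_sat_N atom_sat_ren_atom)
qed

text \<open>The following two predicates express \<open>(M, d) \<le>\<^sub>\<delta> (N, rep)\<close> and \<open>(N, rep) \<le>\<^sub>\<gamma> (M, d)\<close> on \<open>D\<close> in
  terms of the chain.\<close>

definition below_limit :: "countable_ordinal \<Rightarrow> nat set \<Rightarrow> nat \<Rightarrow> (nat \<Rightarrow> 'a) \<Rightarrow> bool" where
  "below_limit \<delta> D m d \<longleftrightarrow> d \<in> vals M \<and>
    (\<exists>s. \<delta> \<le> \<beta> s \<and> D \<subseteq> {..<k s} \<and> m \<le> k s \<and> bfv \<delta> D m d (v s))"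

definition above_limit :: "countable_ordinal \<Rightarrow> nat set \<Rightarrow> nat \<Rightarrow> (nat \<Rightarrow> 'a) \<Rightarrow> bool" where
  "above_limit \<gamma> D m d \<longleftrightarrow> d \<in> vals M \<and>
    (\<exists>s. D \<subseteq> {..<k s} \<and> m \<le> k s \<and> (\<forall>t\<ge>s. bfv \<gamma> D m (v t) d))"

section \<open>Back-and-forth between \<open>M\<close> and the limit\<close>

lemma below_limit_less: "below_limit \<delta> D m d \<Longrightarrow> \<delta> < \<alpha>"
  using \<beta>_less le_less_trans by (auto simp: below_limit_def)

lemma below_limit_atom:
  assumes "below_limit \<delta> D m d" "ren_atom \<sigma> A \<in> e ` {..<m}" "\<sigma> ` atom_vars A \<subseteq> D"
  shows "atom_sat M (d \<circ> \<sigma>) A \<longleftrightarrow> atom_sat N (rep \<circ> \<sigma>) A"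
proof -
  obtain s where s: "D \<subseteq> {..<k s}" "m \<le> k s" "bfv \<delta> D m d (v s)"
    using assms(1) by (auto simp: below_limit_def)
  obtain i where i: "i < m" "ren_atom \<sigma> A = e i" using assms(2) by auto
  have "atom_sat M (d \<circ> \<sigma>) A \<longleftrightarrow> atom_sat M (v s \<circ> \<sigma>) A"
    using bfv_atom[OF s(3) i(1)] i(2) assms(3) by (metis atom_sat_ren_atom atom_vars_ren_atom)
  also have "\<dots> \<longleftrightarrow> atom_sat N (rep \<circ> \<sigma>) A"
    using assms(3) s(1,2) i by (intro atom_sat_N_stage[symmetric]) auto
  finally show ?thesis .
qed

lemma above_limit_atom:
  assumes "above_limit \<gamma> D m d" "ren_atom \<sigma> A \<in> e ` {..<m}" "\<sigma> ` atom_vars A \<subseteq> D"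
  shows "atom_sat M (d \<circ> \<sigma>) A \<longleftrightarrow> atom_sat N (rep \<circ> \<sigma>) A"
proof -
  obtain s where s: "D \<subseteq> {..<k s}" "m \<le> k s" "bfv \<gamma> D m (v s) d"
    using assms(1) by (auto simp: above_limit_def)
  obtain i where i: "i < m" "ren_atom \<sigma> A = e i" using assms(2) by auto
  have "atom_sat M (d \<circ> \<sigma>) A \<longleftrightarrow> atom_sat M (v s \<circ> \<sigma>) A"
    using bfv_atom[OF s(3) i(1)] i(2) assms(3) by (metis atom_sat_ren_atom atom_vars_ren_atom)
  also have "\<dots> \<longleftrightarrow> atom_sat N (rep \<circ> \<sigma>) A"
    using assms(3) s(1,2) i by (intro atom_sat_N_stage[symmetric]) auto
  finally show ?thesis .
qed

text \<open>At a late stage \<open>t\<close> all names in \<open>C\<close> are in use, and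
  \<open>d\<close> still lies below \<open>v t\<close> because \<open>\<delta>\<close> does not
  exceed the promised level. The challenge \<open>v t\<close> is then answered by
  \<open>d'\<close>.\<close>

lemma below_limit_forth:
  assumes "below_limit \<delta> D m d" "\<gamma> < \<delta>" "finite C"
  obtains d' m' where "\<And>x. x \<in> D \<Longrightarrow> d' x = d x" "above_limit \<gamma> (D \<union> C) m' d'" "covers r (D \<union> C) m'"
proof -
  obtain s where d: "d \<in> vals M" and s: "\<delta> \<le> \<beta> s" "D \<subseteq> {..<k s}" "m \<le> k s" "bfv \<delta> D m d (v s)"
    using assms(1) by (auto simp: below_limit_def)
  have fin: "finite (D \<union> C)" using s(2) assms(3) finite_subset by auto
  then obtain m' where m': "covers r (D \<union> C) m'" using ex_covers by blast
  obtain l where l: "D \<union> C \<subseteq> {..<l}" using fin finite_nat_iff_bounded by blast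
  obtain t where t: "s \<le> t" "max l m' \<le> k t" using k_unbounded by blast
  have "bfv \<delta> {..<k s} (k s) (v s) (v t)" using bfv_chain[OF t(1)] s(1) by (rule bfv_mono)
  then have "bfv \<delta> D m (v s) (v t)"
    by (rule bfv_restrict[OF _ v_vals v_vals]) (use s in auto)
  then have "bfv \<delta> D m d (v t)" using s(4) by (blast intro: bfv_trans)
  then obtain d' where d': "d' \<in> vals M" "\<And>x. x \<in> D \<Longrightarrow> d' x = d x" "bfv \<gamma> (D \<union> C) m' (v t) d'"
    by (rule bfv_forth[OF _ assms(2) v_vals fin]) auto
  \<comment> \<open>The chain moves upwards, yet \<open>above_limit\<close> asks for every later
    stage. As \<open>\<gamma> < \<beta> t\<close>, \<open>bfv_reverse\<close> puts
    \<open>v t'\<close> below \<open>v t\<close> at level \<open>\<gamma>\<close>.\<close>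
  have "bfv \<gamma> (D \<union> C) m' (v t') d'" if t': "t \<le> t'" for t'
  proof -
    have "\<gamma> < \<beta> t" using assms(2) s(1) \<beta>_mono[OF t(1)] by auto
    then have "bfv \<gamma> {..<k t} (k t) (v t') (v t)"
      by (intro bfv_reverse[OF bfv_chain[OF t'] _ v_vals]) auto
    then have "bfv \<gamma> (D \<union> C) m' (v t') (v t)"
      by (rule bfv_restrict[OF _ v_vals v_vals]) (use l t(2) in auto)
    then show ?thesis using d'(3) by (rule bfv_trans)
  qed
  then have "above_limit \<gamma> (D \<union> C) m' d'"
    unfolding above_limit_def using d'(1) l t(2) by (intro conjI exI[of _ t]) auto
  then show thesis using that d'(2) m' by blast
qed

text \<open>A stage meeting the matching \<open>realizes\<close> requirement provides the names,
  starting from \<open>c = k t\<close>. The next stage promises at least level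
  \<open>\<delta>\<close>, as \<open>below_limit\<close> asks.\<close>

lemma above_limit_forth:
  assumes "above_limit \<gamma> D m d" "\<delta> < \<gamma>" "\<delta> < \<alpha>" "set wl \<subseteq> universe M"
  obtains c d' m' where "\<And>x. x \<in> D \<Longrightarrow> d' x = d x" "\<And>z. z < length wl \<Longrightarrow> d' (c + z) = wl ! z"
    "below_limit \<delta> (D \<union> {c..<c + length wl}) m' d'" "covers r (D \<union> {c..<c + length wl}) m'"
proof -
  obtain s where d: "d \<in> vals M" and s: "D \<subseteq> {..<k s}" "\<forall>t\<ge>s. bfv \<gamma> D m (v t) d"
    using assms(1) by (auto simp: above_limit_def)
  \<comment> \<open>Requirements are coded by lists, so \<open>d\<close> is replaced by a list that
    agrees with it on \<open>D\<close>.\<close>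
  define dl where "dl = map d [0..<k s]"
  have dl: "list_val dl x = d x" if "x \<in> D" for x
    using that s(1) by (auto simp: dl_def list_val_map)
  have dlU: "set dl \<subseteq> universe M" using d by (auto simp: dl_def vals_iff)
  have finD: "finite D" using s(1) finite_subset by blast
  obtain t where t: "s \<le> t"
    "realizes D dl wl r \<delta> (k t, v t, \<beta> t) (k (Suc t), v (Suc t), \<beta> (Suc t))"
    using realizes_chain[OF finD dlU assms(4,3)] by blast
  have D: "D \<subseteq> {..<k t}" using s(1) k_mono[OF t(1)] by auto
  have "bfv \<gamma> D m (v t) (list_val dl)"
    using s(2) t(1) dl by (auto intro: bfv_cong)
  then have "\<exists>\<gamma>>\<delta>. \<exists>m. bfv \<gamma> D m (v t) (list_val dl)" using assms(2) by blast
  let ?D = "D \<union> {k t..<k t + length wl}"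
  let ?d = "\<lambda>x. if x \<in> D then list_val dl x else list_val wl (x - k t)"
  have *: "k t < k (Suc t)" "k t + length wl \<le> k (Suc t)" "\<delta> \<le> \<beta> (Suc t)"
    "covers r ?D (k (Suc t))" "bfv \<delta> ?D (k (Suc t)) ?d (v (Suc t))"
    using t(2) D \<open>\<exists>\<gamma>>\<delta>. \<exists>m. bfv \<gamma> D m (v t) (list_val dl)\<close> by auto
  have "?d \<in> vals M"
    using list_val_in_vals[OF dlU] list_val_in_vals[OF assms(4)] by (auto simp: vals_iff)
  moreover have "?D \<subseteq> {..<k (Suc t)}" using D *(1,2) by auto
  ultimately have "below_limit \<delta> ?D (k (Suc t)) ?d"
    unfolding below_limit_def using *(3,5) by blast
  moreover have "?d x = d x" if "x \<in> D" for x using dl that by simp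
  moreover have "?d (k t + z) = wl ! z" if "z < length wl" for z
    using that D by (auto simp: list_val_def)
  ultimately show thesis using that[of ?d "k t" "k (Suc t)"] *(4) by blast
qed

lemma above_limit_top: "d \<in> vals M \<Longrightarrow> above_limit \<gamma> {} 0 d"
  unfolding above_limit_def
  using bfv_cong[OF bfv_refl[of d \<gamma> "{}" 0]] by auto

text \<open>These are the atomic facts about names that \<open>bf_0\<close> inspects at the tuple
  \<open>xs\<close>.\<close>

definition list_atoms :: "nat list \<Rightarrow> 'r atom set" where
  "list_atoms xs = ren_atom ((!) xs) ` {A \<in> e ` {..<length xs}. atom_vars A \<subseteq> {..<length xs}}"

lemma covers_list_atoms:
  assumes "covers (length xs) D m" "set xs \<subseteq> D"
  shows "list_atoms xs \<subseteq> e ` {..<m}"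
proof -
  have "(!) xs ` atom_vars A \<subseteq> D" if "atom_vars A \<subseteq> {..<length xs}" for A :: "'r atom"
    using that assms(2) by (auto simp: subset_iff)
  then show ?thesis using assms(1) unfolding list_atoms_def covers_def by auto
qed

lemma bf_0_limit:
  assumes "\<And>\<sigma> A. ren_atom \<sigma> A \<in> e ` {..<m} \<Longrightarrow> \<sigma> ` atom_vars A \<subseteq> D \<Longrightarrow>
      atom_sat M (d \<circ> \<sigma>) A \<longleftrightarrow> atom_sat N (rep \<circ> \<sigma>) A"
    and "set xs \<subseteq> D" "list_atoms xs \<subseteq> e ` {..<m}"
  shows "bf_0 e M N (map d xs) (map rep xs)" "bf_0 e N M (map rep xs) (map d xs)"
proof -
  have "atom_sat M ((!) (map d xs)) (e i) \<longleftrightarrow> atom_sat N ((!) (map rep xs)) (e i)"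
    if i: "i < length xs" "atom_vars (e i) \<subseteq> {..<length xs}" for i
  proof -
    have "ren_atom ((!) xs) (e i) \<in> e ` {..<m}"
      using assms(3) i by (auto simp: list_atoms_def)
    moreover have "(!) xs ` atom_vars (e i) \<subseteq> D" using i(2) assms(2) by (auto simp: subset_iff)
    ultimately have "atom_sat M (d \<circ> (!) xs) (e i) \<longleftrightarrow> atom_sat N (rep \<circ> (!) xs) (e i)"
      by (rule assms(1))
    moreover have "atom_sat M ((!) (map d xs)) (e i) \<longleftrightarrow> atom_sat M (d \<circ> (!) xs) (e i)"
      using i(2) by (intro atom_sat_cong) (auto simp: subset_iff)
    moreover have "atom_sat N ((!) (map rep xs)) (e i) \<longleftrightarrow> atom_sat N (rep \<circ> (!) xs) (e i)"
      using i(2) by (intro atom_sat_cong) (auto simp: subset_iff)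
    ultimately show ?thesis by simp
  qed
  then show "bf_0 e M N (map d xs) (map rep xs)" "bf_0 e N M (map rep xs) (map d xs)"
    by (auto simp: bf_0_def)
qed

text \<open>The two directions are proved together, since an answer in one is an instance of the
  other at a lower level. Above the limit the level \<open>\<alpha>\<close> itself is allowed, as
  every challenge lowers it.\<close>

lemma
  shows below_limit_bf_le: "\<lbrakk>below_limit \<gamma> D m d; set xs \<subseteq> D; list_atoms xs \<subseteq> e ` {..<m}\<rbrakk> \<Longrightarrow>
      bf_le e M N \<gamma> (map d xs) (map rep xs)"
    and above_limit_bf_le: "\<lbrakk>above_limit \<gamma> D m d; \<gamma> \<le> \<alpha>; set xs \<subseteq> D; list_atoms xs \<subseteq> e ` {..<m}\<rbrakk> \<Longrightarrow>
      bf_le e N M \<gamma> (map rep xs) (map d xs)"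
proof (induction \<gamma> arbitrary: D m d xs rule: less_induct)
  case (less \<gamma>)
  {
    case 1
    show ?case
    proof (cases "\<gamma> = 0")
      case True
      then show ?thesis
        using bf_0_limit(1)[OF below_limit_atom[OF 1(1)] 1(2,3)] by (simp add: bf_le_0)
    next
      case False
      then have "0 < \<gamma>" using zero_le_countable_ordinal[of \<gamma>] by simp
      then show ?thesis
      proof (subst bf_le_pos, safe)
        fix \<delta> n c assume \<delta>: "\<delta> < \<gamma>" and c: "c \<in> tuples N n"
        \<comment> \<open>Elements of \<open>N\<close> are names, so \<open>set c\<close> can be the
          finite set to add. The bound is taken for the length of the extended tuple, which governs
          \<open>bf_0\<close> at level 0.\<close>
        obtain d' m' where d': "\<And>x. x \<in> D \<Longrightarrow> d' x = d x" "above_limit \<delta> (D \<union> set c) m' d'"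
          "covers (length (xs @ c)) (D \<union> set c) m'"
          by (rule below_limit_forth[OF 1(1) \<delta>, of "set c"]) auto
        have sub: "set (xs @ c) \<subseteq> D \<union> set c" using 1(2) by auto
        have "\<delta> \<le> \<alpha>" using \<delta> below_limit_less[OF 1(1)] by simp
        from less(2)[OF \<delta> d'(2) this sub covers_list_atoms[OF d'(3) sub]]
        have "bf_le e N M \<delta> (map rep xs @ map rep c) (map d' xs @ map d' c)" by simp
        moreover have "map rep c = c" using c rep_universe by (intro map_idI) (auto simp: tuples_def)
        moreover have "map d' xs = map d xs" using d'(1) 1(2) by auto
        moreover have "map d' c \<in> tuples M n"
          using c d'(2) by (auto simp: tuples_def above_limit_def vals_iff)
        ultimately show "\<exists>a\<in>tuples M n. bf_le e N M \<delta> (map rep xs @ c) (map d xs @ a)" by metis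
      qed
    qed
  next
    case 2
    show ?case
    proof (cases "\<gamma> = 0")
      case True
      then show ?thesis
        using bf_0_limit(2)[OF above_limit_atom[OF 2(1)] 2(3,4)] by (simp add: bf_le_0)
    next
      case False
      then have "0 < \<gamma>" using zero_le_countable_ordinal[of \<gamma>] by simp
      then show ?thesis
      proof (subst bf_le_pos, safe)
        fix \<delta> n a assume \<delta>: "\<delta> < \<gamma>" and a: "a \<in> tuples M n"
        have \<delta>a: "\<delta> < \<alpha>" "set a \<subseteq> universe M" using \<delta> 2(2) a by (auto simp: tuples_def)
        obtain c d' m' where d': "\<And>x. x \<in> D \<Longrightarrow> d' x = d x"
          "\<And>z. z < length a \<Longrightarrow> d' (c + z) = a ! z"
          "below_limit \<delta> (D \<union> {c..<c + length a}) m' d'"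
          "covers (length xs + length a) (D \<union> {c..<c + length a}) m'"
          by (rule above_limit_forth[OF 2(1) \<delta> \<delta>a, where r = "length xs + length a"]) blast
        let ?ys = "[c..<c + length a]"
        have sub: "set (xs @ ?ys) \<subseteq> D \<union> {c..<c + length a}" using 2(3) by auto
        from less(1)[OF \<delta> d'(3) sub covers_list_atoms[OF _ sub]] d'(4)
        have "bf_le e M N \<delta> (map d' xs @ map d' ?ys) (map rep xs @ map rep ?ys)" by simp
        moreover have "map d' ?ys = a" using d'(2) by (intro nth_equalityI) auto
        moreover have "map d' xs = map d xs" using d'(1) 2(3) by auto
        moreover have "map rep ?ys \<in> tuples N n"
          using a rep_in_universe by (auto simp: tuples_def)
        ultimately show "\<exists>b\<in>tuples N n. bf_le e M N \<delta> (map d xs @ a) (map rep xs @ b)" by metis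
      qed
    qed
  }
qed

lemma limit_bf_le: "bf_le e N M \<alpha> [] []"
proof -
  have "above_limit \<alpha> {} 0 (v 0)" by (rule above_limit_top[OF v_vals])
  from above_limit_bf_le[OF this, of "[]"] show ?thesis by (simp add: list_atoms_def)
qed

section \<open>Transfer of formulas to the limit\<close>

lemma covers_fm_atoms:
  assumes "covers r D m" "fm_atoms \<chi> \<subseteq> e ` {..<r}" "finitary_qf L \<chi>" "\<sigma> ` fv \<chi> \<subseteq> D"
  shows "ren_atom \<sigma> ` fm_atoms \<chi> \<subseteq> e ` {..<m}"
proof (rule image_subsetI)
  fix A assume A: "A \<in> fm_atoms \<chi>"
  then have "\<sigma> ` atom_vars A \<subseteq> D" using assms(4) atom_vars_subset_fv[OF assms(3) A] by blast
  moreover have "A \<in> e ` {..<r}" using assms(2) A by (rule subsetD)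
  ultimately show "ren_atom \<sigma> A \<in> e ` {..<m}"
    by (intro assms(1)[unfolded covers_def, THEN bspec, THEN spec, THEN mp])
qed

lemma sat_limit_qf:
  assumes "\<And>\<sigma> A. ren_atom \<sigma> A \<in> e ` {..<m} \<Longrightarrow> \<sigma> ` atom_vars A \<subseteq> D \<Longrightarrow>
      atom_sat M (d \<circ> \<sigma>) A \<longleftrightarrow> atom_sat N (rep \<circ> \<sigma>) A"
    and "finitary_qf L \<chi>" "\<sigma> ` fv \<chi> \<subseteq> D" "ren_atom \<sigma> ` fm_atoms \<chi> \<subseteq> e ` {..<m}"
  shows "sat M \<chi> (d \<circ> \<sigma>) \<longleftrightarrow> sat N \<chi> (rep \<circ> \<sigma>)"
  using assms(2)
proof (rule sat_finitary_qf_cong)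
  fix A assume "A \<in> fm_atoms \<chi>"
  then show "atom_sat M (d \<circ> \<sigma>) A \<longleftrightarrow> atom_sat N (rep \<circ> \<sigma>) A"
    using assms(3,4) atom_vars_subset_fv[OF assms(2)] by (intro assms(1)) blast+
qed

text \<open>A double induction as for \<open>bf_le\<close>: elements of \<open>N\<close> chosen for
  a universal block are matched in \<open>M\<close> by \<open>below_limit_forth\<close>, and
  witnesses in \<open>M\<close> for an existential block obtain names by
  \<open>above_limit_forth\<close>.\<close>

lemma
  shows below_limit_sat: "\<lbrakk>below_limit \<gamma> D m d; is_Pi L \<gamma> \<chi>; \<sigma> ` fv \<chi> \<subseteq> D;
        finitary_qf L \<chi> \<longrightarrow> ren_atom \<sigma> ` fm_atoms \<chi> \<subseteq> e ` {..<m}; sat M \<chi> (d \<circ> \<sigma>)\<rbrakk> \<Longrightarrow>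
      sat N \<chi> (rep \<circ> \<sigma>)"
    and above_limit_sat: "\<lbrakk>above_limit \<gamma> D m d; \<gamma> \<le> \<alpha>; is_Sigma L \<gamma> \<chi>; \<sigma> ` fv \<chi> \<subseteq> D;
        finitary_qf L \<chi> \<longrightarrow> ren_atom \<sigma> ` fm_atoms \<chi> \<subseteq> e ` {..<m}; sat M \<chi> (d \<circ> \<sigma>)\<rbrakk> \<Longrightarrow>
      sat N \<chi> (rep \<circ> \<sigma>)"
proof (induction \<gamma> arbitrary: D m d \<chi> \<sigma> rule: less_induct)
  case (less \<gamma>)
  {
    case 1
    show ?case
    proof (cases "\<gamma> = 0")
      case True
      then have "finitary_qf L \<chi>" using 1(2) by (simp add: is_Pi_0_iff)
      then show ?thesis using sat_limit_qf[OF below_limit_atom[OF 1(1)]] 1(3-5) by blast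
    next
      case False
      then have "0 < \<gamma>" using zero_le_countable_ordinal[of \<gamma>] by simp
      then obtain I f where \<chi>: "\<chi> = Conj I f" and
        f: "\<forall>i\<in>I. \<exists>ys \<psi> \<delta>. f i = foldr Forall ys \<psi> \<and> \<delta> < \<gamma> \<and> is_Sigma L \<delta> \<psi>"
        using is_Pi_posD[OF 1(2)] by blast
      have "sat N (f i) (rep \<circ> \<sigma>)" if i: "i \<in> I" for i
      proof -
        obtain ys \<psi> \<delta> where \<psi>: "f i = foldr Forall ys \<psi>" "\<delta> < \<gamma>" "is_Sigma L \<delta> \<psi>" using f i by blast
        show ?thesis unfolding \<psi>(1) sat_foldr_Forall
        proof (intro allI impI)
          fix w assume w: "\<forall>x. x \<notin> set ys \<longrightarrow> w x = (rep \<circ> \<sigma>) x" "\<forall>x\<in>set ys. w x \<in> universe N"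
          \<comment> \<open>A quantified variable is sent to its own value in \<open>N\<close>,
            which is a name fixed by \<open>rep\<close>.\<close>
          define \<tau> where "\<tau> = (\<lambda>x. if x \<in> set ys then w x else \<sigma> x)"
          have w_eq: "w = rep \<circ> \<tau>" using w rep_universe by (auto simp: \<tau>_def)
          obtain r where r: "finitary_qf L \<psi> \<longrightarrow> fm_atoms \<psi> \<subseteq> e ` {..<r}" by (rule qf_atoms_bound)
          obtain d' m' where d': "\<And>x. x \<in> D \<Longrightarrow> d' x = d x"
            "above_limit \<delta> (D \<union> w ` set ys) m' d'" "covers r (D \<union> w ` set ys) m'"
            by (rule below_limit_forth[OF 1(1) \<psi>(2), of "w ` set ys"]) auto
          have fv: "\<sigma> x \<in> D" if "x \<in> fv \<psi>" "x \<notin> set ys" for x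
          proof -
            have "x \<in> fv (f i)" using that by (simp add: \<psi>(1) fv_foldr_Forall)
            then show ?thesis using 1(3) i \<chi> by auto
          qed
          then have \<tau>: "\<tau> ` fv \<psi> \<subseteq> D \<union> w ` set ys" by (auto simp: \<tau>_def)
          \<comment> \<open>\<open>u\<close> equals \<open>d \<circ> \<sigma>\<close> everywhere off
            \<open>ys\<close>, as the universal block demands; with \<open>d' \<circ> \<tau>\<close>
            it is compared on the free variables of \<open>\<psi>\<close> only.\<close>
          define u where "u = (\<lambda>x. if x \<in> set ys then d' (w x) else d (\<sigma> x))"
          have "d' \<in> vals M" using d'(2) by (simp add: above_limit_def)
          moreover have "sat M (foldr Forall ys \<psi>) (d \<circ> \<sigma>)" 
            using 1(5)[unfolded \<chi> sat.simps] i unfolding \<psi>(1)[symmetric] by blast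
          ultimately have "sat M \<psi> u" unfolding sat_foldr_Forall by (auto simp: u_def vals_iff)
          moreover have "sat M \<psi> (d' \<circ> \<tau>) \<longleftrightarrow> sat M \<psi> u"
            by (rule sat_cong) (use fv d'(1) in \<open>auto simp: u_def \<tau>_def\<close>)
          ultimately have "sat M \<psi> (d' \<circ> \<tau>)" by simp
          moreover have "\<delta> \<le> \<alpha>" using \<psi>(2) below_limit_less[OF 1(1)] by simp
          moreover have "finitary_qf L \<psi> \<longrightarrow> ren_atom \<tau> ` fm_atoms \<psi> \<subseteq> e ` {..<m'}"
            using covers_fm_atoms[OF d'(3) _ _ \<tau>] r by blast
          ultimately show "sat N \<psi> w" unfolding w_eq
            using less(2)[OF \<psi>(2) d'(2) _ \<psi>(3) \<tau>] by blast
        qed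
      qed
      then show ?thesis unfolding \<chi> sat.simps by blast
    qed
  next
    case 2
    show ?case
    proof (cases "\<gamma> = 0")
      case True
      then have "finitary_qf L \<chi>" using 2(3) by (simp add: is_Sigma_0_iff)
      then show ?thesis using sat_limit_qf[OF above_limit_atom[OF 2(1)]] 2(4-6) by blast
    next
      case False
      then have "0 < \<gamma>" using zero_le_countable_ordinal[of \<gamma>] by simp
      then obtain I f where \<chi>: "\<chi> = Disj I f" and
        f: "\<forall>i\<in>I. \<exists>ys \<psi> \<delta>. f i = foldr Exists ys \<psi> \<and> \<delta> < \<gamma> \<and> is_Pi L \<delta> \<psi>"
        using is_Sigma_posD[OF 2(3)] by blast
      obtain i where i: "i \<in> I" "sat M (f i) (d \<circ> \<sigma>)" 
        using 2(6)[unfolded \<chi> sat.simps] by blast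
      obtain ys \<psi> \<delta> where \<psi>: "f i = foldr Exists ys \<psi>" "\<delta> < \<gamma>" "is_Pi L \<delta> \<psi>" using f i(1) by blast
      obtain w where w: "\<forall>x. x \<notin> set ys \<longrightarrow> w x = (d \<circ> \<sigma>) x" "\<forall>x\<in>set ys. w x \<in> universe M" "sat M \<psi> w"
        using i(2) unfolding \<psi>(1) sat_foldr_Exists by blast
      have "d \<in> vals M" using 2(1) by (simp add: above_limit_def)
      then have w_vals: "w x \<in> universe M" for x using w(1,2) by (cases "x \<in> set ys") (auto simp: vals_iff)
      obtain K where K: "set ys \<subseteq> {..<K}" using finite_nat_iff_bounded by blast
      obtain r where r: "finitary_qf L \<psi> \<longrightarrow> fm_atoms \<psi> \<subseteq> e ` {..<r}" by (rule qf_atoms_bound)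
      have \<delta>w: "\<delta> < \<alpha>" "set (map w [0..<K]) \<subseteq> universe M" using \<psi>(2) 2(2) w_vals by auto
      obtain c d' m' where d': "\<And>x. x \<in> D \<Longrightarrow> d' x = d x"
          "\<And>z. z < length (map w [0..<K]) \<Longrightarrow> d' (c + z) = map w [0..<K] ! z"
          "below_limit \<delta> (D \<union> {c..<c + length (map w [0..<K])}) m' d'"
          "covers r (D \<union> {c..<c + length (map w [0..<K])}) m'"
        by (rule above_limit_forth[OF 2(1) \<psi>(2) \<delta>w, where r = r]) blast
      \<comment> \<open>The list passed to \<open>above_limit_forth\<close> has \<open>w x\<close>
        at each place \<open>x < K\<close>, so the variable \<open>x\<close> of the block is named
        \<open>c + x\<close>.\<close>
      define \<tau> where "\<tau> = (\<lambda>x. if x \<in> set ys then c + x else \<sigma> x)"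
      have fv: "\<sigma> x \<in> D" if "x \<in> fv \<psi>" "x \<notin> set ys" for x
      proof -
        have "x \<in> fv (f i)" using that by (simp add: \<psi>(1) fv_foldr_Exists)
        then show ?thesis using 2(4) i \<chi> by auto
      qed
      have \<tau>: "\<tau> ` fv \<psi> \<subseteq> D \<union> {c..<c + length (map w [0..<K])}"
        using fv K by (auto simp: \<tau>_def)
      have "sat M \<psi> (d' \<circ> \<tau>) \<longleftrightarrow> sat M \<psi> w"
        by (rule sat_cong) (use fv d'(1,2) K w(1) in \<open>auto simp: \<tau>_def subset_iff\<close>)
      then have "sat M \<psi> (d' \<circ> \<tau>)" using w(3) by simp
      moreover have "finitary_qf L \<psi> \<longrightarrow> ren_atom \<tau> ` fm_atoms \<psi> \<subseteq> e ` {..<m'}"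
        using covers_fm_atoms[OF d'(4) _ _ \<tau>] r by blast
      ultimately have "sat N \<psi> (rep \<circ> \<tau>)" using less(1)[OF \<psi>(2) d'(3) \<psi>(3) \<tau>] by blast
      then have "sat N (f i) (rep \<circ> \<sigma>)" unfolding \<psi>(1) sat_foldr_Exists
        by (intro exI[of _ "rep \<circ> \<tau>"]) (auto simp: \<tau>_def rep_in_universe)
      then show ?thesis unfolding \<chi> sat.simps using i(1) by blast
    qed
  }
qed

text \<open>By reflexivity at stage \<open>s\<close>, the tuple \<open>v s\<close> itself lies below
  the limit at every level up to \<open>\<beta> s\<close>.\<close>

lemma Pi_forced_limit:
  assumes "Pi_forced \<chi> \<sigma> (k s, v s, \<beta> s)"
  shows "sat N \<chi> (rep \<circ> \<sigma>)"
proof -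
  obtain \<delta> where \<delta>: "\<delta> \<le> \<beta> s" "is_Pi L \<delta> \<chi>" using assms by auto
  have "below_limit \<delta> {..<k s} (k s) (v s)"
    using \<delta>(1) v_vals bfv_refl[OF v_vals] by (auto simp: below_limit_def)
  then show ?thesis using below_limit_sat \<delta>(2) assms by auto
qed

lemma Sigma_forced_limit:
  assumes "Sigma_forced \<psi> \<sigma> (k s, v s, \<beta> s)"
  shows "sat N \<psi> (rep \<circ> \<sigma>)"
  using assms unfolding Sigma_forced_def
proof
  assume "\<exists>I f i ys \<chi> \<sigma>'. \<psi> = Disj I f \<and> i \<in> I \<and> f i = foldr Exists ys \<chi> \<and>
      (\<forall>x. x \<notin> set ys \<longrightarrow> \<sigma>' x = \<sigma> x) \<and> Pi_forced \<chi> \<sigma>' (k s, v s, \<beta> s)"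
  then obtain I f i ys \<chi> \<sigma>' where \<psi>: "\<psi> = Disj I f" "i \<in> I" "f i = foldr Exists ys \<chi>"
      "\<forall>x. x \<notin> set ys \<longrightarrow> \<sigma>' x = \<sigma> x" "Pi_forced \<chi> \<sigma>' (k s, v s, \<beta> s)" by blast
  have "sat N (f i) (rep \<circ> \<sigma>)" unfolding \<psi>(3) sat_foldr_Exists
    using \<psi>(4) Pi_forced_limit[OF \<psi>(5)]
    by (intro exI[of _ "rep \<circ> \<sigma>'"]) (auto simp: rep_in_universe)
  then show ?thesis unfolding \<psi>(1) sat.simps using \<psi>(2) by blast
qed (rule Pi_forced_limit)

end

section \<open>A chain meeting all requirements of the sentence and the types\<close>

theorem theorem1p7:
  fixes L :: "'r language"
    and e :: "nat \<Rightarrow> 'r atom"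
    and M :: "('r, 'a) relstruct"
    and \<alpha> :: countable_ordinal
    and n :: "nat \<Rightarrow> nat"
    and \<Gamma> :: "nat \<Rightarrow> 'r fm set"
    and \<phi> :: "'r fm"
  assumes "countable (dom L)"
    and "range e = atoms L"
    and "universe M \<noteq> {}" and "countable (universe M)"
    and "1 \<le> \<alpha>"
    and "\<And>i. Pi_type L \<alpha> (n i) (\<Gamma> i)"
    and "\<And>i. \<not> Sigma_supported L \<alpha> M (n i) (\<Gamma> i)"
    and "is_Pi L (osucc \<alpha>) \<phi>" and "sentence \<phi>" and "models M \<phi>"
  shows "\<exists>N :: ('r, nat) relstruct. universe N \<noteq> {} \<and>
    bf_le e N M \<alpha> [] [] \<and> models N \<phi> \<and> (\<forall>i. omits N (n i) (\<Gamma> i))"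
proof -
  have pos: "0 < \<alpha>" using assms(5) by (simp add: one_le_countable_ordinal_iff)
  interpret conditions L e M \<alpha> by unfold_locales (use assms(2-4) pos in auto)
  have "0 < osucc \<alpha>" using zero_le_countable_ordinal by (simp add: less_osucc_iff)
  then obtain I f where \<phi>: "\<phi> = Conj I f" and
    "\<forall>i\<in>I. \<exists>ys \<psi> \<gamma>. f i = foldr Forall ys \<psi> \<and> \<gamma> < osucc \<alpha> \<and> is_Sigma L \<gamma> \<psi>"
    using is_Pi_posD[OF assms(8)] by blast
  then obtain ys \<psi> \<gamma> where
    f: "\<And>i. i \<in> I \<Longrightarrow> f i = foldr Forall (ys i) (\<psi> i)" and
    \<gamma>: "\<And>i. i \<in> I \<Longrightarrow> \<gamma> i \<le> \<alpha>" and
    \<psi>: "\<And>i. i \<in> I \<Longrightarrow> is_Sigma L (\<gamma> i) (\<psi> i)"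
    by (metis less_osucc_iff)
  have fv: "fv (\<psi> i) \<subseteq> set (ys i)" if i: "i \<in> I" for i
  proof -
    have "fv (f i) = {}" using assms(9) i by (auto simp: sentence_def \<phi>)
    then show ?thesis using f[OF i] by (simp add: fv_foldr_Forall)
  qed
  \<comment> \<open>As \<open>\<phi>\<close> is a sentence, the free variables of
    \<open>\<psi> i\<close> belong to its block. So \<open>\<psi> i\<close> is true at every
    valuation in \<open>vals M\<close>, and its instances may be demanded of any condition.\<close>
  have sat_\<psi>: "sat M (\<psi> i) w" if i: "i \<in> I" and w: "w \<in> vals M" for i w
  proof -
    let ?u = "\<lambda>x. if x \<in> set (ys i) then w x else [] ! x"
    have "sat M (foldr Forall (ys i) (\<psi> i)) ((!) [])"
      using assms(10) i unfolding f[OF i, symmetric] by (simp add: models_def tuple_sat_def \<phi>)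
    then have "sat M (\<psi> i) ?u"
      unfolding sat_foldr_Forall by (rule allE[of _ ?u]) (use w in \<open>simp add: vals_iff\<close>)
    moreover have "sat M (\<psi> i) w \<longleftrightarrow> sat M (\<psi> i) ?u" by (rule sat_cong) (use fv[OF i] in auto)
    ultimately show ?thesis by simp
  qed

  \<comment> \<open>Three kinds of requirements: back-and-forth, instances of \<open>\<phi>\<close>
    at names, and omission of the types at names. Coding assignments of names by lists keeps them
    countable in number.\<close>
  define Q\<^sub>1 where "Q\<^sub>1 = (\<lambda>(D, dl, wl, r, \<delta>). realizes D dl wl r \<delta>) `
    ({D. finite D} \<times> lists (universe M) \<times> lists (universe M) \<times> UNIV \<times> {..<\<alpha>})"
  define q\<^sub>2 :: "nat \<times> nat list \<Rightarrow> 'a cond \<Rightarrow> 'a cond \<Rightarrow> bool" where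
    "q\<^sub>2 = (\<lambda>(i, ts) p p'. names ts ` fv (\<psi> i) \<subseteq> {..<fst p} \<longrightarrow> Sigma_forced (\<psi> i) (names ts) p')"
  define q\<^sub>3 :: "nat \<times> nat list \<Rightarrow> 'a cond \<Rightarrow> 'a cond \<Rightarrow> bool" where
    "q\<^sub>3 = (\<lambda>(i, xs) p p'. length xs = n i \<longrightarrow> set xs \<subseteq> {..<fst p} \<longrightarrow>
      (\<exists>\<gamma>\<in>\<Gamma> i. Sigma_forced (dual \<gamma>) (names xs) p'))"
  let ?Q = "Q\<^sub>1 \<union> q\<^sub>2 ` (I \<times> UNIV) \<union> range q\<^sub>3"
  have "countable Q\<^sub>1" unfolding Q\<^sub>1_def
    using countable_lessThan_countable_ordinal countable_Collect_finite countable_universe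
    by (intro countable_image countable_SIGMA countable_lists) auto
  then have "countable ?Q" by auto
  moreover have "cond (0, \<lambda>_. elem, 0)" using pos elem_in_universe by (simp add: vals_iff)
  moreover have "\<exists>p'. cond p' \<and> ext p p' \<and> q p p'" if q: "q \<in> ?Q" and p: "cond p" for q p
  proof -
    obtain k v \<beta> where p_eq: "p = (k, v, \<beta>)" by (metis prod_cases3)
    consider "q \<in> Q\<^sub>1" | i ts where "i \<in> I" "q = q\<^sub>2 (i, ts)" | i xs where "q = q\<^sub>3 (i, xs)"
      using q by auto
    then show ?thesis
    proof cases
      case 1
      then obtain D dl wl r \<delta> where "q = realizes D dl wl r \<delta>"
        "set dl \<subseteq> universe M" "set wl \<subseteq> universe M" "\<delta> < \<alpha>"
        unfolding Q\<^sub>1_def lists_eq_set by clarsimp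
      then show ?thesis using ex_realizes p unfolding p_eq by blast
    next
      case (2 i ts)
      show ?thesis
      proof (cases "names ts ` fv (\<psi> i) \<subseteq> {..<k}")
        case True
        have "v \<circ> names ts \<in> vals M" using p by (auto simp: p_eq vals_iff)
        then have "sat M (\<psi> i) (v \<circ> names ts)" using sat_\<psi>[OF 2(1)] by blast
        then show ?thesis
          using ex_Sigma_forced[OF p[unfolded p_eq] \<psi>[OF 2(1)] \<gamma>[OF 2(1)] True]
          unfolding p_eq 2(2) q\<^sub>2_def by auto
      next
        case False
        then show ?thesis using ext_refl[OF p] p unfolding 2(2) q\<^sub>2_def p_eq by auto
      qed
    next
      case (3 i xs)
      show ?thesis
      proof (cases "length xs = n i \<and> set xs \<subseteq> {..<k}")
        case True
        then show ?thesis
          using ex_omitting[OF p[unfolded p_eq] assms(6,7)] unfolding p_eq 3 q\<^sub>3_def by auto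
      next
        case False
        then show ?thesis using ext_refl[OF p] p unfolding 3 q\<^sub>3_def p_eq by auto
      qed
    qed
  qed
  moreover have "?Q \<noteq> {}" by auto
  ultimately obtain s where s: "\<And>t. cond (s t)" "\<And>t. ext (s t) (s (Suc t))"
    "\<And>q t. q \<in> ?Q \<Longrightarrow> \<exists>t'\<ge>t. q (s t') (s (Suc t'))"
    using generic_sequence[of ?Q cond _ ext] by metis
  define k v \<beta> where "k = (\<lambda>t. fst (s t))" "v = (\<lambda>t. fst (snd (s t)))" "\<beta> = (\<lambda>t. snd (snd (s t)))"
  have s_eq: "s t = (k t, v t, \<beta> t)" for t by (simp add: k_v_\<beta>_def)
  interpret generic_chain L e M \<alpha> k v \<beta>
  proof
    show "cond (k t, v t, \<beta> t)" "ext (k t, v t, \<beta> t) (k (Suc t), v (Suc t), \<beta> (Suc t))" for t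
      using s(1,2)[of t] by (simp_all add: s_eq)
    show "\<exists>t'\<ge>t. realizes D dl wl r \<delta> (k t', v t', \<beta> t') (k (Suc t'), v (Suc t'), \<beta> (Suc t'))"
      if "finite D" "set dl \<subseteq> universe M" "set wl \<subseteq> universe M" "\<delta> < \<alpha>" for D dl wl r \<delta> t
    proof -
      have "realizes D dl wl r \<delta> \<in> Q\<^sub>1" unfolding Q\<^sub>1_def
        by (rule image_eqI[where x = "(D, dl, wl, r, \<delta>)"]) (use that in \<open>simp_all add: lists_eq_set\<close>)
      then have "\<exists>t'\<ge>t. realizes D dl wl r \<delta> (s t') (s (Suc t'))" by (intro s(3)) blast
      then show ?thesis unfolding s_eq .
    qed
  qed
  \<comment> \<open>\<open>q\<^sub>2\<close> and \<open>q\<^sub>3\<close> demand nothing while a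
    name is missing. As each requirement recurs and \<open>k\<close> is unbounded, it is also met
    after all names in \<open>B\<close> are present.\<close>
  have stage: "\<exists>t. B \<subseteq> {..<k t} \<and> q (s t) (s (Suc t))" if q: "q \<in> ?Q" and B: "finite B" for q B
  proof -
    obtain l where l: "B \<subseteq> {..<l}" using B finite_nat_iff_bounded by blast
    obtain t where "l \<le> k t" using k_unbounded[of 0 l] by blast
    moreover obtain t' where "t \<le> t'" "q (s t') (s (Suc t'))" using s(3)[OF q] by blast
    ultimately show ?thesis using l k_mono[of t t'] by (intro exI[of _ t']) auto
  qed
  have "sat N (f i) ((!) [])" if i: "i \<in> I" for i
    unfolding f[OF i] sat_foldr_Forall
  proof (intro allI impI)
    fix w assume w: "\<forall>x\<in>set (ys i). w x \<in> universe N"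
    obtain K where K: "set (ys i) \<subseteq> {..<K}" using finite_nat_iff_bounded by blast
    \<comment> \<open>The values of \<open>w\<close> on the block are elements of \<open>N\<close>,
      hence names; \<open>K\<close> bounds the block, so \<open>ts\<close> records all of
      them.\<close>
    define ts where "ts = map w [0..<K]"
    have ts: "names ts x = w x" if "x \<in> fv (\<psi> i)" for x
      using that fv[OF i] K by (auto simp: ts_def names_def)
    have "finite (names ts ` fv (\<psi> i))" using fv[OF i] finite_subset by blast
    then obtain t where "names ts ` fv (\<psi> i) \<subseteq> {..<k t}" "q\<^sub>2 (i, ts) (s t) (s (Suc t))"
      using stage[of "q\<^sub>2 (i, ts)" "names ts ` fv (\<psi> i)"] i by blast
    then have "Sigma_forced (\<psi> i) (names ts) (k (Suc t), v (Suc t), \<beta> (Suc t))"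
      by (simp add: q\<^sub>2_def s_eq)
    then have "sat N (\<psi> i) (rep \<circ> names ts)" by (rule Sigma_forced_limit)
    moreover have "sat N (\<psi> i) w \<longleftrightarrow> sat N (\<psi> i) (rep \<circ> names ts)"
    proof (rule sat_cong)
      fix x assume x: "x \<in> fv (\<psi> i)"
      then have "w x \<in> universe N" using w fv[OF i] by blast
      then show "w x = (rep \<circ> names ts) x" using ts[OF x] rep_universe by simp
    qed
    ultimately show "sat N (\<psi> i) w" by simp
  qed
  then have "models N \<phi>" by (simp add: models_def tuple_sat_def \<phi>)
  moreover have "omits N (n i) (\<Gamma> i)" for i
    unfolding omits_def
  proof
    assume "\<exists>a\<in>tuples N (n i). \<forall>\<gamma>\<in>\<Gamma> i. tuple_sat N a \<gamma>"
    then obtain a where a: "length a = n i" "set a \<subseteq> universe N" "\<forall>\<gamma>\<in>\<Gamma> i. tuple_sat N a \<gamma>"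
      by (auto simp: tuples_def)
    \<comment> \<open>The tuple \<open>a\<close> is itself a list of names, each its own
      representative.\<close>
    obtain t where "set a \<subseteq> {..<k t}" "q\<^sub>3 (i, a) (s t) (s (Suc t))"
      using stage[of "q\<^sub>3 (i, a)" "set a"] by blast
    then obtain \<gamma>' where \<gamma>': "\<gamma>' \<in> \<Gamma> i"
      "Sigma_forced (dual \<gamma>') (names a) (k (Suc t), v (Suc t), \<beta> (Suc t))"
      using a(1) by (auto simp: q\<^sub>3_def s_eq)
    have "\<not> sat N \<gamma>' (rep \<circ> names a)"
      using Sigma_forced_limit[OF \<gamma>'(2)] unfolding sat_dual .
    moreover have "sat N \<gamma>' ((!) a) \<longleftrightarrow> sat N \<gamma>' (rep \<circ> names a)"
    proof (rule sat_cong)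
      fix x assume "x \<in> fv \<gamma>'"
      then have "x < length a" using assms(6)[of i] \<gamma>'(1) a(1) by (auto simp: Pi_type_def)
      moreover from this have "a ! x \<in> universe N" using a(2) nth_mem by blast
      ultimately show "a ! x = (rep \<circ> names a) x" using rep_universe by (simp add: names_def)
    qed
    ultimately show False using a(3) \<gamma>'(1) by (simp add: tuple_sat_def)
  qed
  moreover have "universe N \<noteq> {}" using rep_in_universe by blast
  ultimately show ?thesis using limit_bf_le by blast
qed

end
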